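(* Let $(\mu_n)_{n\in\mathbb N}$ be a sequence of Fourier transformable measures on $\mathbb R^d$, and let $\mu$ be a Fourier transformable measure on $\mathbb R^d$ such that (i) $(\mu_n)_{n\in\mathbb N}$ converges to $\mu$ in the tempered distribution topology, and (ii) $\{\widehat{\mu_n}: n\in\mathbb N\}$ is vaguely bounded. Then $(\widehat{\mu_n})_{n\in\mathbb N}$ converges vaguely to $\widehat\mu$.
   Context: Measures on $\mathbb R^d$ are complex Radon measures (linear functionals on $C_c(\mathbb R^d)$ bounded in sup norm on functions supported in any fixed compact set). Conventions: $\check f(y)=\int f(x)e^{2\pi i xy}dx$, $\widetilde f(x)=\overline{f(-x)}$. A measure $\mu$ is Fourier transformable if there is a measure $\widehat\mu$ with $\check f\in L^2(\widehat\mu)$ and $\mu(f*\widetilde f)=\widehat\mu(|\check f|^2)$ for all $f\in C_c(\mathbb R^d)$; Fourier transformable measures are tempered distributions. Convergence in the tempered distribution topology means $\mu_n(f)\to\mu(f)$ for all Schwartz functions $f\in\mathcal S(\mathbb R^d)$ (all measures being tempered). Vague convergence: $\mu_n(f)\to\mu(f)$ for all $f\in C_c(\mathbb R^d)$. A set $\mathcal A$ of measures is vaguely bounded if $\{\nu(f):\nu\in\mathcal A\}$ is bounded for every $f\in C_c(\mathbb R^d)$. *)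

theory Defs
  imports "HOL-Analysis.Analysis"
begin

text \<open>A complex Radon measure on R^d is represented by its polar decomposition:
  a locally finite positive Borel measure nu (the total variation) together with a
  Borel density h of modulus one; the measure is h * nu.\<close>

type_synonym 'd rmeasure = "(real^'d) measure \<times> (real^'d \<Rightarrow> complex)"

definition radon :: "'d::finite rmeasure \<Rightarrow> bool" where
  "radon m \<longleftrightarrow> sets (fst m) = sets borel
     \<and> (\<forall>K. compact K \<longrightarrow> emeasure (fst m) K < \<infinity>)
     \<and> snd m \<in> borel_measurable borel
     \<and> (\<forall>x. cmod (snd m x) = 1)"

definition mapply :: "'d::finite rmeasure \<Rightarrow> (real^'d \<Rightarrow> complex) \<Rightarrow> complex" where
  "mapply m f = integral\<^sup>L (fst m) (\<lambda>x. f x * snd m x)"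

definition in_L2 :: "'d::finite rmeasure \<Rightarrow> (real^'d \<Rightarrow> complex) \<Rightarrow> bool" where
  "in_L2 m g \<longleftrightarrow> g \<in> borel_measurable (fst m) \<and> integrable (fst m) (\<lambda>x. (cmod (g x))^2)"

definition cc :: "(real^'d::finite \<Rightarrow> complex) \<Rightarrow> bool" where
  "cc f \<longleftrightarrow> continuous_on UNIV f \<and> (\<exists>K. compact K \<and> (\<forall>x. x \<notin> K \<longrightarrow> f x = 0))"

definition fconv :: "(real^'d::finite \<Rightarrow> complex) \<Rightarrow> (real^'d \<Rightarrow> complex) \<Rightarrow> real^'d \<Rightarrow> complex" where
  "fconv f g x = integral\<^sup>L lborel (\<lambda>y. f y * g (x - y))"

definition tilde :: "(real^'d::finite \<Rightarrow> complex) \<Rightarrow> real^'d \<Rightarrow> complex" where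
  "tilde f x = cnj (f (- x))"

definition fcheck :: "(real^'d::finite \<Rightarrow> complex) \<Rightarrow> real^'d \<Rightarrow> complex" where
  "fcheck f y = integral\<^sup>L lborel (\<lambda>x. f x * cis (2 * pi * (x \<bullet> y)))"

definition ft_pair :: "'d::finite rmeasure \<Rightarrow> 'd rmeasure \<Rightarrow> bool" where
  "ft_pair mu muh \<longleftrightarrow> radon mu \<and> radon muh \<and>
     (\<forall>f. cc f \<longrightarrow> in_L2 muh (fcheck f) \<and>
        mapply mu (fconv f (tilde f)) = mapply muh (\<lambda>y. complex_of_real ((cmod (fcheck f y))^2)))"

definition vaguely_bounded :: "'d::finite rmeasure set \<Rightarrow> bool" where
  "vaguely_bounded A \<longleftrightarrow> (\<forall>f. cc f \<longrightarrow> bounded ((\<lambda>m. mapply m f) ` A))"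

definition partial :: "'d::finite \<Rightarrow> (real^'d \<Rightarrow> complex) \<Rightarrow> real^'d \<Rightarrow> complex" where
  "partial i f x = vector_derivative (\<lambda>t::real. f (x + t *\<^sub>R axis i 1)) (at 0)"

fun pderivs :: "'d::finite list \<Rightarrow> (real^'d \<Rightarrow> complex) \<Rightarrow> real^'d \<Rightarrow> complex" where
  "pderivs [] f = f"
| "pderivs (i # is) f = partial i (pderivs is f)"

definition smooth :: "(real^'d::finite \<Rightarrow> complex) \<Rightarrow> bool" where
  "smooth f \<longleftrightarrow> (\<forall>is. continuous_on UNIV (pderivs is f) \<and>
      (\<forall>i x. (\<lambda>t::real. pderivs is f (x + t *\<^sub>R axis i 1)) differentiable (at 0)))"

definition schwartz :: "(real^'d::finite \<Rightarrow> complex) \<Rightarrow> bool" where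
  "schwartz f \<longleftrightarrow> smooth f \<and>
     (\<forall>(k::nat) is. bounded (range (\<lambda>x. (1 + norm x) ^ k * cmod (pderivs is f x))))"

definition seminorm :: "nat \<Rightarrow> 'd::finite list \<Rightarrow> (real^'d \<Rightarrow> complex) \<Rightarrow> real" where
  "seminorm k is f = (SUP x. (1 + norm x) ^ k * cmod (pderivs is f x))"

definition tempered_dist :: "((real^'d::finite \<Rightarrow> complex) \<Rightarrow> complex) \<Rightarrow> bool" where
  "tempered_dist T \<longleftrightarrow>
     (\<forall>f g a b. schwartz f \<longrightarrow> schwartz g \<longrightarrow>
        T (\<lambda>x. a * f x + b * g x) = a * T f + b * T g) \<and>
     (\<exists>C N. \<forall>f. schwartz f \<longrightarrow>
        cmod (T f) \<le> C * (\<Sum>k\<le>N. \<Sum>is\<in>{is::'d list. length is \<le> N}. seminorm k is f))"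

text \<open>T is the tempered distribution determined by the measure mu (it agrees
  with mu on smooth compactly supported functions, which are dense in S).\<close>
definition tempered_ext :: "'d::finite rmeasure \<Rightarrow> ((real^'d \<Rightarrow> complex) \<Rightarrow> complex) \<Rightarrow> bool" where
  "tempered_ext mu T \<longleftrightarrow> tempered_dist T \<and>
     (\<forall>\<phi>. smooth \<phi> \<and> cc \<phi> \<longrightarrow> T \<phi> = mapply mu \<phi>)"

definition tempered_conv :: "(nat \<Rightarrow> 'd::finite rmeasure) \<Rightarrow> 'd rmeasure \<Rightarrow> bool" where
  "tempered_conv mus mu \<longleftrightarrow> (\<exists>Ts T. (\<forall>n. tempered_ext (mus n) (Ts n)) \<and> tempered_ext mu T \<and>
      (\<forall>f. schwartz f \<longrightarrow> (\<lambda>n. Ts n f) \<longlonglongrightarrow> T f))"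

end

theory Submission
  imports Defs
begin

text \<open>
  The difficulty is that \<open>\<nu> = \<mu>^\<close> is only known to integrate \<open>|f^|\<^sup>2\<close> for \<open>f\<close> in \<open>C\<^sub>c\<close>, and no bound on the
  tails of the \<open>\<nu>\<^sub>n\<close> is uniform in \<open>n\<close>. One therefore tests with \<open>k * f * f~\<close>, where \<open>f\<close> is a smooth
  bump and \<open>k\<close> is continuous and rapidly decaying. Cutting \<open>k\<close> off gives functions in \<open>C\<^sub>c\<close>, to which
  the (polarized) defining identity applies; on the Fourier side \<open>|f^|\<^sup>2\<close> is a \<open>\<nu>\<close>-integrable
  majorant, and on the other side the cutoffs converge in the Schwartz space. Hence
  \<open>T(k * f * f~) = \<nu>(k^ |f^|\<^sup>2)\<close> for the tempered distribution \<open>T\<close> of \<open>\<mu>\<close>, and so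
  \<open>\<nu>\<^sub>n(k^ |f^|\<^sup>2)\<close> converges to \<open>\<nu>(k^ |f^|\<^sup>2)\<close>.

  Given \<open>\<phi>\<close> in \<open>C\<^sub>c\<close>, choose \<open>f\<close> so concentrated that \<open>f^\<close> has no zero on the support of \<open>\<phi>\<close>, and
  approximate \<open>\<phi> / |f^|\<^sup>2\<close> uniformly by some \<open>k^\<close> supported in a fixed compact set. The error is
  uniform in \<open>n\<close>, because by the uniform boundedness principle a vaguely bounded sequence is
  equicontinuous on the functions supported in a fixed compact set.
\<close>

subsection \<open>Uniform boundedness\<close>

text \<open>The obstacle is that a nonzero \<open>k\<close> and its transform
  \<open>fcheck k\<close> cannot both have compact support: the identity in \<open>ft_pair\<close>
  is available for C_c functions only, while the vague topology calls for \<open>fcheck k\<close> of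
  compact support. The support condition is therefore spent on the Fourier side: \<open>k\<close> is
  taken as \<open>fcheck w\<close> with \<open>w\<close> smooth of compact support, so
  \<open>k\<close> decays rapidly and, by inversion, \<open>fcheck k\<close> is a multiple of the
  reflected \<open>w\<close>. The two convolution factors have separate duties. The inner one turns
  weighted integrability of \<open>k\<close> into weighted sup bounds; the outer one takes all
  derivatives, so \<open>k\<close> is never differentiated and a piecewise linear cutoff suffices.
  With \<open>tilde f = f\<close> the test function is the convolution of \<open>fconv k f\<close>
  with \<open>tilde f\<close>, which calls for polarization because the defining identity pairs a
  function only with itself.\<close>

lemma uniform_boundedness_principle:
  fixes T :: "nat \<Rightarrow> 'a::{real_normed_vector,complete_space} \<Rightarrow> 'b::real_normed_vector"
  assumes lin: "\<And>n. bounded_linear (T n)"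
    and bdd: "\<And>x. bounded (range (\<lambda>n. T n x))"
  shows "\<exists>M. \<forall>n x. norm (T n x) \<le> M * norm x"
proof -
  \<comment> \<open>Baire category: by pointwise boundedness the closed sets \<open>A m\<close>
    exhaust the space, so one of them contains a closed ball.\<close>
  define A where "A m = {x. \<forall>n. norm (T n x) \<le> real m}" for m :: nat
  have clA: "closed (A m)" for m
  proof -
    have "A m = (\<Inter>n. {x. norm (T n x) \<le> real m})" unfolding A_def by blast
    moreover have "closed {x. norm (T n x) \<le> real m}" for n
      by (intro closed_Collect_le continuous_on_norm continuous_on_const
          linear_continuous_on[OF lin])
    ultimately show ?thesis by (auto intro!: closed_INT)
  qed
  have un: "(\<Union>m. A m) = UNIV"
  proof -
    have "\<exists>m. x \<in> A m" for x
    proof -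
      obtain B where B: "\<And>n. norm (T n x) \<le> B"
        using bdd[of x] by (auto simp: bounded_iff)
      obtain m :: nat where "B \<le> real m" using real_arch_simple by blast
      then have "x \<in> A m" using B order_trans unfolding A_def by blast
      then show ?thesis ..
    qed
    then show ?thesis by auto
  qed
  have "\<exists>m. interior (A m) \<noteq> {}"
  proof (rule ccontr)
    assume "\<not> ?thesis"
    then have *: "closedin euclidean S \<and> euclidean interior_of S = {}" if "S \<in> range A" for S
      using that clA unfolding euclidean_interior_of closed_closedin[symmetric] by blast
    have "euclidean interior_of \<Union>(range A) = {}"
      by (rule Baire_category_alt[OF disjI1[OF completely_metrizable_space_euclidean] _ *]) auto
    then show False using un by (simp only: euclidean_interior_of interior_UNIV UNIV_not_empty)
  qed
  then obtain m x0 where "x0 \<in> interior (A m)" by blast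
  then obtain r where r: "r > 0" "cball x0 r \<subseteq> A m"
    by (meson interior_subset mem_interior_cball)
  have "norm (T n x) \<le> (2 * real m / r) * norm x" for n x
  proof (cases "x = 0")
    case True
    then show ?thesis using bounded_linear.linear[OF lin[of n]] by (simp add: linear_0)
  next
    case False
    interpret bounded_linear "T n" by (rule lin)
    \<comment> \<open>Scaling \<open>x\<close> to length \<open>r\<close> keeps
      \<open>x0 + s *\<^sub>R x\<close> in the closed ball. Two values of norm at most
      \<open>m\<close> differ by at most \<open>2 * m\<close>, whence the constant
      \<open>2 * real m / r\<close>.\<close>
    define s where "s = r / norm x"
    have s: "s > 0" using r False by (simp add: s_def)
    have "x0 + s *\<^sub>R x \<in> A m" "x0 \<in> A m"
      using r(1) False by (auto simp: s_def dist_norm intro!: subsetD[OF r(2)])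
    then have "norm (T n (x0 + s *\<^sub>R x)) \<le> m" "norm (T n x0) \<le> m"
      by (auto simp: A_def)
    then have "norm (T n (x0 + s *\<^sub>R x) - T n x0) \<le> 2 * real m"
      using norm_triangle_ineq4[of "T n (x0 + s *\<^sub>R x)" "T n x0"] by linarith
    then have "s * norm (T n x) \<le> 2 * real m" using s by (simp add: add scaleR)
    then show ?thesis using r False by (simp add: s_def field_simps)
  qed
  then show ?thesis by blast
qed

subsection \<open>Smooth bump functions\<close>

text \<open>One witness \<open>D\<close> carries all derivatives, so that iterated partial
  derivatives of a product over the coordinates can be written out in terms of
  \<open>D\<close>.\<close>

definition smooth_real :: "(real \<Rightarrow> real) \<Rightarrow> bool" where
  "smooth_real f \<longleftrightarrow>
     (\<exists>D. D 0 = f \<and> (\<forall>n x. (D n has_real_derivative D (Suc n) x) (at x)))"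

text \<open>Spares a formula for the n-th derivative: choosing a derivative inside \<open>S\<close>
  and iterating the choice produces the whole sequence.\<close>

lemma smooth_real_coinduct:
  assumes "f \<in> S"
    and "\<And>g. g \<in> S \<Longrightarrow> \<exists>g'\<in>S. \<forall>x. (g has_real_derivative g' x) (at x)"
  shows "smooth_real f"
proof -
  obtain d where d: "\<And>g. g \<in> S \<Longrightarrow> d g \<in> S \<and> (\<forall>x. (g has_real_derivative d g x) (at x))"
    using assms(2) by metis
  define D where "D n = (d ^^ n) f" for n
  have "D n \<in> S" for n by (induction n) (auto simp: D_def d assms(1))
  then show ?thesis unfolding smooth_real_def
    by (intro exI[of _ D]) (auto simp: D_def d)
qed

lemma smooth_real_mult:
  assumes "smooth_real f" "smooth_real g"
  shows "smooth_real (\<lambda>x. f x * g x)"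
proof -
  obtain D where D: "D 0 = f" "\<And>n x. (D n has_real_derivative D (Suc n) x) (at x)"
    using assms(1) by (auto simp: smooth_real_def)
  obtain E where E: "E 0 = g" "\<And>n x. (E n has_real_derivative E (Suc n) x) (at x)"
    using assms(2) by (auto simp: smooth_real_def)
  \<comment> \<open>The sums of products \<open>D i * E j\<close> are closed under differentiation.\<close>
  define F where "F l x = (\<Sum>p\<leftarrow>l. D (fst p) x * E (snd p) x)" for l x
  have der: "\<exists>l'. \<forall>x. (F l has_real_derivative F l' x) (at x)" for l
  proof (induction l)
    case Nil
    have "(F [] has_real_derivative F [] x) (at x)" for x by (simp add: F_def[abs_def])
    then show ?case by blast
  next
    case (Cons p l)
    then obtain l' where l': "\<And>x. (F l has_real_derivative F l' x) (at x)" by blast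
    have "(F (p # l) has_real_derivative
        F ((Suc (fst p), snd p) # (fst p, Suc (snd p)) # l') x) (at x)" for x
    proof -
      have "F (p # l) = (\<lambda>x. D (fst p) x * E (snd p) x + F l x)"
        by (auto simp: F_def)
      moreover have "F ((Suc (fst p), snd p) # (fst p, Suc (snd p)) # l') x =
          (D (Suc (fst p)) x * E (snd p) x + D (fst p) x * E (Suc (snd p)) x) + F l' x"
        by (simp add: F_def)
      ultimately show ?thesis
        by (simp only:) (auto intro!: derivative_eq_intros D E l')
    qed
    then show ?case by blast
  qed
  have "(\<lambda>x. f x * g x) \<in> range F"
    by (rule range_eqI[of _ _ "[(0,0)]"]) (simp add: F_def D E fun_eq_iff)
  then show ?thesis by (rule smooth_real_coinduct) (use der in auto)
qed

lemma smooth_real_affine: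
  assumes "smooth_real f"
  shows "smooth_real (\<lambda>x. f (a + c * x))"
proof -
  obtain D where D: "D 0 = f" "\<And>n x. (D n has_real_derivative D (Suc n) x) (at x)"
    using assms(1) by (auto simp: smooth_real_def)
  have "((\<lambda>x. c ^ n * D n (a + c * x)) has_real_derivative
      c ^ Suc n * D (Suc n) (a + c * x)) (at x)" for n x
  proof -
    have "((\<lambda>x. a + c * x) has_real_derivative c) (at x)"
      by (auto intro!: derivative_eq_intros)
    from DERIV_cmult[OF DERIV_chain2[OF D(2) this], of "c ^ n" n]
    show ?thesis by (simp add: mult_ac)
  qed
  then show ?thesis unfolding smooth_real_def
    by (intro exI[of _ "\<lambda>n x. c ^ n * D n (a + c * x)"]) (auto simp: D)
qed

lemma poly_times_exp_minus_tendsto_0: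
  "((\<lambda>x. poly p x * exp (- x)) \<longlongrightarrow> 0) (at_top :: real filter)"
proof -
  have "((\<lambda>x. \<Sum>i\<le>degree p. coeff p i * (x ^ i / exp x)) \<longlongrightarrow> (\<Sum>i\<le>degree p. coeff p i * 0)) at_top"
    by (intro tendsto_sum tendsto_mult tendsto_const tendsto_power_div_exp_0)
  then show ?thesis
    by (simp add: poly_altdef sum_distrib_right exp_minus divide_inverse mult.assoc)
qed

text \<open>The functions p(1/t) exp(-1/t), extended by 0, are closed under differentiation: the
  chain rule replaces \<open>p\<close> by x^2 (p - p'). Only t = 0 needs a limit, and there every
  derivative vanishes because the exponential beats all powers of 1/t.\<close>

lemma smooth_real_exp_inverse:
  "smooth_real (\<lambda>t. if t > 0 then exp (- (1 / t)) else 0)"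
proof -
  define F where "F p t = (if t > 0 then poly p (1 / t) * exp (- (1 / t)) else 0)"
    for p and t :: real
  have der: "(F p has_real_derivative F ([:0, 0, 1:] * (p - pderiv p)) t) (at t)" for p t
  proof -
    consider "t > 0" | "t < 0" | "t = 0" by linarith
    then show ?thesis
    proof cases
      case 1
      have "((\<lambda>t. poly p (1 / t) * exp (- (1 / t))) has_real_derivative
          F ([:0, 0, 1:] * (p - pderiv p)) t) (at t)"
        using 1 unfolding F_def
        by (auto intro!: derivative_eq_intros DERIV_chain2[OF poly_DERIV]
            simp: field_simps power2_eq_square)
      then show ?thesis
        by (rule has_field_derivative_transform_within_open[of _ _ _ "{0<..}"])
           (use 1 in \<open>auto simp: F_def\<close>)
    next
      case 2
      have "((\<lambda>t. 0) has_real_derivative F ([:0, 0, 1:] * (p - pderiv p)) t) (at t)"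
        using 2 by (simp add: F_def)
      then show ?thesis
        by (rule has_field_derivative_transform_within_open[of _ _ _ "{..<0}"])
           (use 2 in \<open>auto simp: F_def\<close>)
    next
      case 3
      have "((\<lambda>h. F p h / h) \<longlongrightarrow> 0) (at 0)"
      proof (subst filterlim_at_split, intro conjI)
        have "\<forall>\<^sub>F h in at_left 0. F p h / h = 0"
          by (auto simp: eventually_at_filter F_def)
        then show "((\<lambda>h. F p h / h) \<longlongrightarrow> 0) (at_left 0)"
          by (rule tendsto_eventually)
        \<comment> \<open>Division by \<open>h\<close> is multiplication by 1/h, so the difference
          quotient is again a polynomial in 1/h times exp(-1/h).\<close>
        have "((\<lambda>h. poly ([:0, 1:] * p) (inverse h) * exp (- inverse h)) \<longlongrightarrow> 0) (at_right 0)"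
          by (rule filterlim_compose[OF poly_times_exp_minus_tendsto_0 filterlim_inverse_at_top_right])
        moreover have "\<forall>\<^sub>F h in at_right 0. poly ([:0, 1:] * p) (inverse h) * exp (- inverse h) = F p h / h"
          by (auto simp: eventually_at_filter F_def field_simps)
        ultimately show "((\<lambda>h. F p h / h) \<longlongrightarrow> 0) (at_right 0)"
          by (rule Lim_transform_eventually)
      qed
      then show ?thesis using 3 by (simp add: DERIV_def F_def)
    qed
  qed
  have "(\<lambda>t. if t > 0 then exp (- (1 / t)) else 0) \<in> range F"
    by (rule range_eqI[of _ _ "1"]) (auto simp: F_def)
  then show ?thesis by (rule smooth_real_coinduct) (use der in auto)
qed

text \<open>A partial derivative in direction \<open>i\<close> acts on the factor with index
  \<open>i\<close> alone. Hence factor \<open>j\<close> is differentiated as often as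
  \<open>j\<close> occurs in the list, whatever the order.\<close>

lemma
  fixes D :: "nat \<Rightarrow> real \<Rightarrow> real"
  assumes D: "\<And>n x. (D n has_real_derivative D (Suc n) x) (at x)"
  shows pderivs_prod_eq: "pderivs is (\<lambda>x::real^'d::finite. complex_of_real (\<Prod>j\<in>UNIV. D 0 (x $ j)))
          = (\<lambda>x. complex_of_real (\<Prod>j\<in>UNIV. D (count_list is j) (x $ j)))"
    and smooth_prod: "smooth (\<lambda>x::real^'d::finite. complex_of_real (\<Prod>j\<in>UNIV. D 0 (x $ j)))"
proof -
  have der: "((\<lambda>t. complex_of_real (\<Prod>j\<in>UNIV. D (n j) ((x + t *\<^sub>R axis i 1) $ j))) has_vector_derivative
       complex_of_real (\<Prod>j\<in>UNIV. D ((n(i := Suc (n i))) j) (x $ j))) (at 0)"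
    for n :: "'d \<Rightarrow> nat" and x :: "real^'d" and i
  proof -
    have split: "(\<Prod>j\<in>UNIV. G j) = G i * (\<Prod>j\<in>UNIV - {i}. G j)" for G :: "'d \<Rightarrow> real"
      by (simp add: prod.remove)
    have "((\<lambda>t. x $ i + t) has_real_derivative 1) (at 0)"
      by (auto intro!: derivative_eq_intros)
    from DERIV_chain2[OF D this, of "n i"]
    have "((\<lambda>t. D (n i) (x $ i + t) * (\<Prod>j\<in>UNIV - {i}. D (n j) (x $ j))) has_real_derivative
        D (Suc (n i)) (x $ i) * (\<Prod>j\<in>UNIV - {i}. D (n j) (x $ j))) (at 0)"
      by (auto intro!: derivative_eq_intros)
    moreover have "(\<Prod>j\<in>UNIV. D (n j) ((x + t *\<^sub>R axis i 1) $ j)) =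
        D (n i) (x $ i + t) * (\<Prod>j\<in>UNIV - {i}. D (n j) (x $ j))" for t
      by (subst split) (auto simp: axis_def intro!: prod.cong)
    moreover have "(\<Prod>j\<in>UNIV. D ((n(i := Suc (n i))) j) (x $ j)) =
        D (Suc (n i)) (x $ i) * (\<Prod>j\<in>UNIV - {i}. D (n j) (x $ j))"
      by (subst split) (auto intro!: prod.cong)
    ultimately have "((\<lambda>t. \<Prod>j\<in>UNIV. D (n j) ((x + t *\<^sub>R axis i 1) $ j)) has_vector_derivative
       (\<Prod>j\<in>UNIV. D ((n(i := Suc (n i))) j) (x $ j))) (at 0)"
      by (simp only: has_real_derivative_iff_has_vector_derivative)
    then show ?thesis
      by (rule bounded_linear.has_vector_derivative[OF bounded_linear_of_real])
  qed
  show eq: "pderivs is (\<lambda>x::real^'d::finite. complex_of_real (\<Prod>j\<in>UNIV. D 0 (x $ j)))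
          = (\<lambda>x. complex_of_real (\<Prod>j\<in>UNIV. D (count_list is j) (x $ j)))" for "is"
  proof (induction "is")
    case (Cons i js)
    have "(count_list js)(i := Suc (count_list js i)) = count_list (i # js)"
      by (auto simp: fun_eq_iff)
    with vector_derivative_at[OF der[of "count_list js" _ i]] show ?case
      by (simp only: pderivs.simps Cons.IH partial_def)
  qed simp
  have contD: "continuous_on UNIV (D n)" for n
    using DERIV_isCont[OF D] by (blast intro: continuous_at_imp_continuous_on)
  have cont: "continuous_on UNIV (\<lambda>x. D n (x $ j))" for n and j :: 'd
    by (rule continuous_on_compose2[OF contD]) (auto intro: continuous_intros)
  show "smooth (\<lambda>x::real^'d::finite. complex_of_real (\<Prod>j\<in>UNIV. D 0 (x $ j)))"
    unfolding smooth_def eq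
  proof (intro allI conjI)
    fix "is" :: "'d list"
    show "continuous_on UNIV (\<lambda>x::real^'d. complex_of_real (\<Prod>j\<in>UNIV. D (count_list is j) (x $ j)))"
      by (intro continuous_on_of_real continuous_on_prod cont)
    show "(\<lambda>t. complex_of_real (\<Prod>j\<in>UNIV. D (count_list is j) ((x + t *\<^sub>R axis i 1) $ j)))
        differentiable (at 0)" for i and x :: "real^'d"
      by (rule differentiableI_vector[OF der])
  qed
qed

text \<open>Evenness makes the real-valued bump a fixed point of \<open>tilde\<close>; positivity at
  0 together with \<open>b x \<ge> 0\<close> will make its integral positive.\<close>

lemma smooth_bump_exists:
  assumes "\<delta> > 0"
  obtains b :: "real^'d::finite \<Rightarrow> real"
  where "smooth (\<lambda>x. complex_of_real (b x))" "\<And>x. b x \<ge> 0" "\<And>x. b (- x) = b x"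
    "b 0 > 0" "\<And>x. norm x > \<delta> \<Longrightarrow> b x = 0"
proof -
  \<comment> \<open>The Euclidean norm is at most the sum of the \<open>CARD('d)\<close> absolute
    coordinates, so \<open>norm x > \<delta>\<close> forces some coordinate to have modulus at least
    \<open>\<eta>\<close>.\<close>
  define \<eta> where "\<eta> = \<delta> / CARD('d)"
  define e :: "real \<Rightarrow> real" where "e t = (if t > 0 then exp (- (1 / t)) else 0)" for t
  \<comment> \<open>Positive exactly for |t| < \<open>\<eta>\<close>, and even because the two
    factors trade places. The coefficients 1 and -1 fit the shape of
    \<open>smooth_real_affine\<close>.\<close>
  define \<beta> where "\<beta> t = e (\<eta> + 1 * t) * e (\<eta> + (-1) * t)" for t
  have "smooth_real e" unfolding e_def by (rule smooth_real_exp_inverse)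
  then have "smooth_real \<beta>"
    unfolding \<beta>_def by (intro smooth_real_mult smooth_real_affine)
  then obtain D where D: "D 0 = \<beta>" "\<And>n x. (D n has_real_derivative D (Suc n) x) (at x)"
    by (auto simp: smooth_real_def)
  define b where "b x = (\<Prod>j\<in>UNIV. \<beta> (x $ j))" for x :: "real^'d"
  have eta: "\<eta> > 0" using assms by (simp add: \<eta>_def)
  show ?thesis
  proof
    show "smooth (\<lambda>x. complex_of_real (b x))"
      unfolding b_def using smooth_prod[of D, OF D(2)] by (simp add: D(1))
    show "b x \<ge> 0" for x by (auto simp: b_def \<beta>_def e_def intro!: prod_nonneg)
    show "b (- x) = b x" for x by (simp add: b_def \<beta>_def mult.commute)
    show "b 0 > 0" using eta by (auto simp: b_def \<beta>_def e_def intro!: prod_pos)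
    show "b x = 0" if "norm x > \<delta>" for x
    proof -
      have "\<exists>j. \<bar>x $ j\<bar> \<ge> \<eta>"
      proof (rule ccontr)
        assume "\<not> ?thesis"
        then have "(\<Sum>j\<in>UNIV. \<bar>x $ j\<bar>) \<le> (\<Sum>j\<in>(UNIV::'d set). \<eta>)"
          by (intro sum_mono) (auto simp: not_le less_imp_le)
        also have "\<dots> = \<delta>" by (simp add: \<eta>_def)
        finally show False using that norm_le_l1_cart[of x] by linarith
      qed
      then obtain j where "\<bar>x $ j\<bar> \<ge> \<eta>" by blast
      then have "\<beta> (x $ j) = 0" using eta by (auto simp: \<beta>_def e_def)
      then show ?thesis by (auto simp: b_def intro!: prod_zero)
    qed
  qed
qed

subsection \<open>Convolution with compactly supported functions\<close>

text \<open>Dominated convergence along a continuous parameter, obtained from sequences. The bound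
  is asked only near \<open>a\<close>: for translated supports and difference quotients the
  majorants found below are local in the parameter.\<close>

lemma tendsto_integral_dominated:
  fixes F :: "'a::first_countable_topology \<Rightarrow> 'b \<Rightarrow> 'c::{banach,second_countable_topology}"
  assumes F: "\<And>t. F t \<in> borel_measurable M" and G: "G \<in> borel_measurable M"
    and w: "integrable M w" and ev: "\<forall>\<^sub>F t in at a. \<forall>y. norm (F t y) \<le> w y"
    and lim: "\<And>y. ((\<lambda>t. F t y) \<longlongrightarrow> G y) (at a)"
  shows "((\<lambda>t. integral\<^sup>L M (F t)) \<longlongrightarrow> integral\<^sup>L M G) (at a)"
  unfolding tendsto_at_iff_sequentially
proof (intro allI impI)
  fix X assume X: "\<forall>i. X i \<in> UNIV - {a}" "X \<longlonglongrightarrow> a"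
  then have flim: "filterlim X (at a) sequentially"
    by (auto simp: filterlim_at)
  then have "\<forall>\<^sub>F i in sequentially. \<forall>y. norm (F (X i) y) \<le> w y"
    by (rule eventually_compose_filterlim[OF ev])
  then obtain N where N: "\<And>i y. i \<ge> N \<Longrightarrow> norm (F (X i) y) \<le> w y"
    by (auto simp: eventually_sequentially)
  have "(\<lambda>i. integral\<^sup>L M (F (X (i + N)))) \<longlonglongrightarrow> integral\<^sup>L M G"
  proof (rule integral_dominated_convergence[where w = w])
    show "AE y in M. (\<lambda>i. F (X (i + N)) y) \<longlonglongrightarrow> G y"
      using filterlim_compose[OF lim flim] by (intro AE_I2 LIMSEQ_ignore_initial_segment)
    show "AE y in M. norm (F (X (i + N)) y) \<le> w y" for i
      by (rule AE_I2) (simp add: N)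
  qed (use F G w in auto)
  then show "((\<lambda>t. integral\<^sup>L M (F t)) \<circ> X) \<longlonglongrightarrow> integral\<^sup>L M G"
    unfolding comp_def by (rule LIMSEQ_offset)
qed

lemma ccI:
  assumes "continuous_on UNIV f" "\<And>x. norm x > r \<Longrightarrow> f x = 0"
  shows "cc f"
  unfolding cc_def using assms by (intro conjI exI[of _ "cball 0 r"]) (auto simp: not_le)

lemma cc_continuous: "cc f \<Longrightarrow> continuous_on UNIV f"
  by (simp add: cc_def)

lemma cc_support:
  assumes "cc f"
  shows "\<exists>r>0. \<forall>x. norm x > r \<longrightarrow> f x = 0"
proof -
  obtain K where K: "compact K" "\<And>x. x \<notin> K \<Longrightarrow> f x = 0" using assms by (auto simp: cc_def)
  then obtain r where "r > 0" "\<And>x. x \<in> K \<Longrightarrow> norm x \<le> r"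
    using compact_imp_bounded[OF K(1)] unfolding bounded_pos by blast
  then show ?thesis using K(2) by (meson not_le)
qed

lemma continuous_bounded_cball:
  fixes f :: "real^'d::finite \<Rightarrow> complex"
  assumes "continuous_on UNIV f"
  shows "\<exists>B>0. \<forall>x. norm x \<le> r \<longrightarrow> cmod (f x) \<le> B"
proof -
  have "compact (f ` cball 0 r)"
    using assms by (intro compact_continuous_image) (auto intro: continuous_on_subset)
  then have "bounded (f ` cball 0 r)" by (rule compact_imp_bounded)
  then show ?thesis unfolding bounded_pos by auto
qed

lemma cc_bounded:
  assumes "cc f"
  shows "\<exists>B>0. \<forall>x. cmod (f x) \<le> B"
proof -
  obtain r where r: "r > 0" "\<And>x. norm x > r \<Longrightarrow> f x = 0" using cc_support[OF assms] by blast
  obtain B where B: "B > 0" "\<And>x. norm x \<le> r \<Longrightarrow> cmod (f x) \<le> B"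
    using continuous_bounded_cball[OF cc_continuous[OF assms]] by blast
  have "cmod (f x) \<le> B" for x
    using r(2)[of x] B by (cases "norm x > r") auto
  then show ?thesis using B(1) by blast
qed

lemma cc_times: "continuous_on UNIV g \<Longrightarrow> cc f \<Longrightarrow> cc (\<lambda>x. g x * f x)"
  unfolding cc_def by (auto intro!: continuous_intros)

lemma cc_cmult: "cc f \<Longrightarrow> cc (\<lambda>x. a * f x)"
  by (rule cc_times) auto

lemma cc_add:
  assumes "cc f" "cc g" shows "cc (\<lambda>x. f x + g x)"
proof -
  obtain r where r: "\<And>x. norm x > r \<Longrightarrow> f x = 0" using cc_support[OF assms(1)] by blast
  obtain s where s: "\<And>x. norm x > s \<Longrightarrow> g x = 0" using cc_support[OF assms(2)] by blast
  show ?thesis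
    by (rule ccI[of _ "max r s"])
       (use r s assms cc_continuous in \<open>auto intro!: continuous_on_add\<close>)
qed

lemma cc_reflect_shift:
  assumes "cc f" shows "cc (\<lambda>y. f (x - y))"
proof -
  obtain r where r: "\<And>y. norm y > r \<Longrightarrow> f y = 0" using cc_support[OF assms] by blast
  show ?thesis
  proof (rule ccI[of _ "r + norm x"])
    show "continuous_on UNIV (\<lambda>y. f (x - y))"
      by (rule continuous_on_compose2[OF cc_continuous[OF assms]]) (auto intro!: continuous_intros)
    show "f (x - y) = 0" if "norm y > r + norm x" for y
      by (rule r) (use that norm_triangle_ineq2[of y x] in \<open>simp add: norm_minus_commute\<close>)
  qed
qed

lemma borel_measurable_continuous_UNIV:
  "continuous_on UNIV f \<Longrightarrow> f \<in> borel_measurable borel"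
  by (rule borel_measurable_continuous_onI)

text \<open>The measure is kept general to serve Lebesgue measure, Lebesgue measure on the product
  space and the variation of a Radon measure alike.\<close>

lemma integrable_bounded_support:
  fixes F :: "'a::euclidean_space \<Rightarrow> 'b::{banach,second_countable_topology}"
  assumes M: "sets M = sets borel" "emeasure M (cball 0 r) < \<infinity>"
    and F: "F \<in> borel_measurable borel" "\<And>x. norm (F x) \<le> B" "\<And>x. norm x > r \<Longrightarrow> F x = 0"
  shows "integrable M F"
proof (rule Bochner_Integration.integrable_bound)
  show "integrable M (\<lambda>x. B * indicator (cball 0 r) x)"
    using M by (intro integrable_mult_right integrable_real_indicator) auto
  show "F \<in> borel_measurable M" using F(1) M(1) by (simp cong: measurable_cong_sets)
  show "AE x in M. norm (F x) \<le> norm (B * indicator (cball 0 r) x)"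
  proof (rule AE_I2)
    fix x show "norm (F x) \<le> norm (B * indicator (cball 0 r) x)"
      using F(2)[of x] F(3)[of x] by (cases "norm x > r") (auto simp: indicator_def)
  qed
qed

lemma emeasure_lborel_cball_less_top: "emeasure lborel (cball (0::'a::euclidean_space) r) < \<infinity>"
  by (rule emeasure_compact_finite) simp

lemma integrable_cc: "cc f \<Longrightarrow> integrable lborel f"
proof -
  assume f: "cc f"
  obtain r where r: "\<And>y. norm y > r \<Longrightarrow> f y = 0" using cc_support[OF f] by blast
  obtain B where B: "\<And>x. cmod (f x) \<le> B" using cc_bounded[OF f] by blast
  show ?thesis
    by (rule integrable_bounded_support[OF _ emeasure_lborel_cball_less_top _ B r])
       (use cc_continuous[OF f] in \<open>auto intro: borel_measurable_continuous_UNIV\<close>)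
qed

lemma fconv_integrable:
  "continuous_on UNIV h \<Longrightarrow> cc \<psi> \<Longrightarrow> integrable lborel (\<lambda>y. h y * \<psi> (x - y))"
  by (intro integrable_cc cc_times cc_reflect_shift)

lemma fconv_integrand_measurable:
  "continuous_on UNIV h \<Longrightarrow> cc \<psi> \<Longrightarrow> (\<lambda>y. h y * \<psi> (x - y)) \<in> borel_measurable lborel"
  using fconv_integrable borel_measurable_integrable by blast

lemma fconv_continuous:
  fixes h :: "real^'d::finite \<Rightarrow> complex"
  assumes h: "continuous_on UNIV h" and \<psi>: "cc \<psi>"
  shows "continuous_on UNIV (fconv h \<psi>)"
proof -
  obtain r where r: "r > 0" "\<And>y. norm y > r \<Longrightarrow> \<psi> y = 0" using cc_support[OF \<psi>] by blast
  obtain B where B: "B > 0" "\<And>x. cmod (\<psi> x) \<le> B" using cc_bounded[OF \<psi>] by blast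
  have "((\<lambda>x. fconv h \<psi> x) \<longlongrightarrow> fconv h \<psi> a) (at a)" for a
  proof -
    \<comment> \<open>For x within distance 1 of \<open>a\<close> the integrand vanishes beyond this
      radius, so the local bound \<open>H\<close> of the possibly unbounded \<open>h\<close>
      suffices.\<close>
    define R where "R = norm a + 1 + r"
    obtain H where H: "H > 0" "\<And>y. norm y \<le> R \<Longrightarrow> cmod (h y) \<le> H"
      using continuous_bounded_cball[OF h, of R] by blast
    show ?thesis unfolding fconv_def
    proof (rule tendsto_integral_dominated[where w = "\<lambda>y. (H * B) * indicator (cball 0 R) y"])
      show "integrable lborel (\<lambda>y::real^'d. (H * B) * indicator (cball 0 R) y)"
        using emeasure_lborel_cball_less_top
        by (intro integrable_mult_right integrable_real_indicator) auto
      have "cmod (h y * \<psi> (x - y)) \<le> H * B * indicator (cball 0 R) y" if "dist x a < 1" for x y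
      proof (cases "norm y \<le> R")
        case True
        then show ?thesis using H B by (auto simp: norm_mult intro!: mult_mono)
      next
        case False
        have "norm y \<le> norm (y - x) + norm (x - a) + norm a" by norm
        then have "norm (x - y) > r" using False that
          by (simp add: R_def dist_norm norm_minus_commute)
        then show ?thesis using r False by simp
      qed
      then show "\<forall>\<^sub>F x in at a. \<forall>y. cmod (h y * \<psi> (x - y)) \<le> (H * B) * indicator (cball 0 R) y"
        unfolding eventually_at by (intro exI[of _ "1::real"] conjI ballI impI allI) simp_all
      show "((\<lambda>x. h y * \<psi> (x - y)) \<longlongrightarrow> h y * \<psi> (a - y)) (at a)" for y
      proof -
        have "isCont \<psi> (a - y)" using cc_continuous[OF \<psi>] by (simp add: continuous_on_eq_continuous_at)
        moreover have "((\<lambda>x. x - y) \<longlongrightarrow> a - y) (at a)" by (intro tendsto_intros)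
        ultimately have "((\<lambda>x. \<psi> (x - y)) \<longlongrightarrow> \<psi> (a - y)) (at a)"
          by (rule isCont_tendsto_compose)
        then show ?thesis by (rule tendsto_mult[OF tendsto_const])
      qed
    qed (use fconv_integrand_measurable[OF h \<psi>] in auto)
  qed
  then show ?thesis by (auto simp: continuous_on_def)
qed

lemma fconv_zero_outside:
  assumes "\<And>x. norm x > r \<Longrightarrow> f x = 0" "\<And>x. norm x > s \<Longrightarrow> g x = 0" "norm x > r + s"
  shows "fconv f g x = 0"
proof -
  have "f y * g (x - y) = 0" for y
  proof (cases "norm y > r")
    case False
    then have "norm (x - y) > s" using assms(3) norm_triangle_ineq2[of x y] by linarith
    then show ?thesis using assms(2) by simp
  qed (use assms in auto)
  then have "(\<lambda>y. f y * g (x - y)) = (\<lambda>y. 0)" by blast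
  then show ?thesis by (simp only: fconv_def integral_zero)
qed

lemma cc_fconv:
  assumes "cc f" "cc g" shows "cc (fconv f g)"
proof -
  obtain r where r: "\<And>x. norm x > r \<Longrightarrow> f x = 0" using cc_support[OF assms(1)] by blast
  obtain s where s: "\<And>x. norm x > s \<Longrightarrow> g x = 0" using cc_support[OF assms(2)] by blast
  show ?thesis
    by (rule ccI[OF fconv_continuous[OF cc_continuous[OF assms(1)] assms(2)] fconv_zero_outside[OF r s]])
qed

section \<open>Differentiation of convolutions under the integral sign\<close>

lemma line_derivative_at:
  fixes \<psi> :: "'a::real_normed_vector \<Rightarrow> 'b::real_normed_vector"
  assumes "\<And>x. ((\<lambda>t. \<psi> (x + t *\<^sub>R e)) has_vector_derivative \<psi>' x) (at 0)"
  shows "((\<lambda>t. \<psi> (x + t *\<^sub>R e)) has_vector_derivative \<psi>' (x + s *\<^sub>R e)) (at s)"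
proof -
  have "((\<lambda>t. t - s) has_vector_derivative 1) (at s)"
    by (auto intro!: derivative_eq_intros)
  then have "((\<lambda>u. \<psi> (x + s *\<^sub>R e + u *\<^sub>R e)) \<circ> (\<lambda>t. t - s) has_vector_derivative
      1 *\<^sub>R \<psi>' (x + s *\<^sub>R e)) (at s)"
    by (rule vector_diff_chain_at) (simp add: assms)
  then show ?thesis by (simp add: comp_def algebra_simps)
qed

lemma line_increment_bound:
  fixes \<psi> :: "'a::real_normed_vector \<Rightarrow> 'b::real_normed_vector"
  assumes "\<And>x. ((\<lambda>t. \<psi> (x + t *\<^sub>R e)) has_vector_derivative \<psi>' x) (at 0)"
    and "\<And>x. norm (\<psi>' x) \<le> B"
  shows "norm (\<psi> (x + t *\<^sub>R e) - \<psi> x) \<le> B * \<bar>t\<bar>"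
proof -
  have "norm (\<psi> (x + t *\<^sub>R e) - \<psi> (x + 0 *\<^sub>R e)) \<le> B * norm (t - 0)"
  proof (rule differentiable_bound[of UNIV "\<lambda>t. \<psi> (x + t *\<^sub>R e)"])
    show "((\<lambda>t. \<psi> (x + t *\<^sub>R e)) has_derivative (\<lambda>h. h *\<^sub>R \<psi>' (x + s *\<^sub>R e))) (at s within UNIV)" for s
      using line_derivative_at[OF assms(1), where s = s and x = x] by (simp add: has_vector_derivative_def)
    show "onorm (\<lambda>h. h *\<^sub>R \<psi>' (x + s *\<^sub>R e)) \<le> B" for s
      by (rule onorm_le) (use mult_right_mono[OF assms(2) abs_ge_zero] in \<open>simp add: mult.commute\<close>)
  qed auto
  then show ?thesis by simp
qed

text \<open>Puts derivatives into the form of limits of difference quotients, in which dominated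
  convergence can deliver them.\<close>

lemma has_vector_derivative_0_iff:
  fixes f :: "real \<Rightarrow> 'a::real_normed_vector"
  shows "(f has_vector_derivative D) (at 0) \<longleftrightarrow> ((\<lambda>t. (f t - f 0) /\<^sub>R t) \<longlongrightarrow> D) (at 0)"
proof -
  have "((f y - f 0) - y *\<^sub>R D) /\<^sub>R \<bar>y\<bar> = sgn y *\<^sub>R ((f y - f 0) /\<^sub>R y - D)" if "y \<noteq> 0" for y
    using that by (simp add: sgn_real_def abs_real_def scaleR_diff_right algebra_simps)
  then have eq: "norm (((f y - f 0) - y *\<^sub>R D) /\<^sub>R \<bar>y\<bar>) = norm ((f y - f 0) /\<^sub>R y - D)" if "y \<noteq> 0" for y
    using that by (simp add: abs_sgn_eq)
  have "(f has_vector_derivative D) (at 0) \<longleftrightarrow>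
      ((\<lambda>y. norm (((f y - f 0) - y *\<^sub>R D) /\<^sub>R \<bar>y\<bar>)) \<longlongrightarrow> 0) (at 0)"
    unfolding has_vector_derivative_def has_derivative_within tendsto_norm_zero_iff
    by (simp add: bounded_linear_scaleR_left diff_diff_eq inverse_eq_divide)
  also have "\<dots> \<longleftrightarrow> ((\<lambda>y. norm ((f y - f 0) /\<^sub>R y - D)) \<longlongrightarrow> 0) (at 0)"
    by (rule filterlim_cong[OF refl refl])
      (unfold eventually_at_filter, rule always_eventually, use eq in blast)
  also have "\<dots> \<longleftrightarrow> ((\<lambda>t. (f t - f 0) /\<^sub>R t) \<longlongrightarrow> D) (at 0)"
    unfolding tendsto_norm_zero_iff by (rule LIM_zero_iff)
  finally show ?thesis .
qed

text \<open>The derivative falls on the compactly supported factor, so \<open>h\<close> may be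
  merely continuous. The mean value inequality bounds the difference quotients of
  \<open>\<psi>\<close> by \<open>B\<close>, and compact support confines them to a fixed
  ball.\<close>

lemma fconv_has_line_derivative:
  fixes h :: "real^'d::finite \<Rightarrow> complex"
  assumes h: "continuous_on UNIV h" and \<psi>: "cc \<psi>" and \<psi>': "cc \<psi>'"
    and der: "\<And>x. ((\<lambda>t. \<psi> (x + t *\<^sub>R e)) has_vector_derivative \<psi>' x) (at 0)"
  shows "((\<lambda>t. fconv h \<psi> (x + t *\<^sub>R e)) has_vector_derivative fconv h \<psi>' x) (at 0)"
proof -
  obtain r where r: "r > 0" "\<And>y. norm y > r \<Longrightarrow> \<psi> y = 0" using cc_support[OF \<psi>] by blast
  obtain B where B: "B > 0" "\<And>x. cmod (\<psi>' x) \<le> B" using cc_bounded[OF \<psi>'] by blast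
  \<comment> \<open>For |t| < 1 the shift by \<open>t *\<^sub>R e\<close> is no longer than
    \<open>norm e\<close>, so one radius works for all these \<open>t\<close>.\<close>
  define R where "R = norm x + norm e + r"
  obtain H where H: "H > 0" "\<And>y. norm y \<le> R \<Longrightarrow> cmod (h y) \<le> H"
    using continuous_bounded_cball[OF h, of R] by blast
  define F where "F t y = (h y * \<psi> (x + t *\<^sub>R e - y) - h y * \<psi> (x - y)) /\<^sub>R t" for t y
  have F_eq: "F t y = h y * ((\<psi> (x - y + t *\<^sub>R e) - \<psi> (x - y)) /\<^sub>R t)" for t y
    by (simp add: F_def algebra_simps)
  have "((\<lambda>t. integral\<^sup>L lborel (F t)) \<longlongrightarrow> fconv h \<psi>' x) (at 0)"
    unfolding fconv_def
  proof (rule tendsto_integral_dominated[where w = "\<lambda>y. (H * B) * indicator (cball 0 R) y"])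
    show "F t \<in> borel_measurable lborel" for t
      unfolding F_def using fconv_integrand_measurable[OF h \<psi>] by (intro borel_measurable_scaleR borel_measurable_diff) auto
    show "(\<lambda>y. h y * \<psi>' (x - y)) \<in> borel_measurable lborel"
      by (rule fconv_integrand_measurable[OF h \<psi>'])
    show "integrable lborel (\<lambda>y::real^'d. (H * B) * indicator (cball 0 R) y)"
      using emeasure_lborel_cball_less_top
      by (intro integrable_mult_right integrable_real_indicator) auto
    have "cmod (F t y) \<le> H * B * indicator (cball 0 R) y" if "t \<noteq> 0" "dist t 0 < 1" for t y
    proof (cases "norm y \<le> R")
      case True
      have "cmod ((\<psi> (x - y + t *\<^sub>R e) - \<psi> (x - y)) /\<^sub>R t) \<le> B"
      proof -
        have "cmod (\<psi> (x - y + t *\<^sub>R e) - \<psi> (x - y)) / \<bar>t\<bar> \<le> B"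
          using line_increment_bound[OF der B(2), of "x - y" t] that
          by (simp add: pos_divide_le_eq)
        then show ?thesis unfolding norm_scaleR abs_inverse by (simp add: divide_inverse mult.commute)
      qed
      then show ?thesis using H(2)[OF True] H(1) B(1) True
        unfolding F_eq norm_mult by (simp add: mult_mono)
    next
      case False
      have t: "norm (t *\<^sub>R e) \<le> norm e" using that by (simp add: mult_left_le_one_le)
      have "norm y \<le> norm (x + t *\<^sub>R e - y) + norm x + norm (t *\<^sub>R e)"
        using norm_triangle_sub[of y "x + t *\<^sub>R e"] norm_triangle_ineq[of x "t *\<^sub>R e"]
        by (simp add: norm_minus_commute)
      then have "norm (x + t *\<^sub>R e - y) > r" using False t by (simp add: R_def)
      moreover have "norm (x - y) > r"
        using False norm_triangle_ineq2[of y x] norm_ge_zero[of e]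
        unfolding R_def norm_minus_commute[of x y] by linarith
      ultimately show ?thesis using r False by (simp add: F_def)
    qed
    then show "\<forall>\<^sub>F t in at 0. \<forall>y. cmod (F t y) \<le> (H * B) * indicator (cball 0 R) y"
      unfolding eventually_at by (intro exI[of _ "1::real"] conjI ballI impI allI) simp_all
    show "((\<lambda>t. F t y) \<longlongrightarrow> h y * \<psi>' (x - y)) (at 0)" for y
      unfolding F_eq using der[of "x - y"]
      unfolding has_vector_derivative_0_iff by (intro tendsto_mult tendsto_const) simp
  qed
  moreover have "integral\<^sup>L lborel (F t) = (fconv h \<psi> (x + t *\<^sub>R e) - fconv h \<psi> (x + 0 *\<^sub>R e)) /\<^sub>R t" for t
    unfolding F_def fconv_def using fconv_integrable[OF h \<psi>] by simp
  ultimately show ?thesis by (simp add: has_vector_derivative_0_iff)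
qed

lemma smooth_has_partial:
  assumes "smooth f"
  shows "((\<lambda>t. pderivs is f (x + t *\<^sub>R axis i 1)) has_vector_derivative pderivs (i # is) f x) (at 0)"
  using assms by (auto simp: smooth_def partial_def vector_derivative_works)

lemma partial_zero_outside:
  assumes "\<And>x. norm x > r \<Longrightarrow> f x = 0" "norm x > r"
  shows "partial i f x = 0"
  unfolding partial_def
proof (rule vector_derivative_at, rule has_vector_derivative_transform_within_open)
  show "((\<lambda>t::real. 0) has_vector_derivative 0) (at 0)" by simp
  show "open {t. norm (x + t *\<^sub>R axis i 1) > r}"
    by (intro open_Collect_less continuous_intros)
qed (use assms in auto)

lemma pderivs_zero_outside:
  assumes "\<And>x. norm x > r \<Longrightarrow> f x = 0" "norm x > r"
  shows "pderivs is f x = 0"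
  using assms(2) by (induction "is" arbitrary: x) (auto simp: assms(1) intro: partial_zero_outside)

lemma cc_pderivs:
  assumes "smooth f" "cc f" shows "cc (pderivs is f)"
proof -
  obtain r where "\<And>x. norm x > r \<Longrightarrow> f x = 0" using cc_support[OF assms(2)] by blast
  then show ?thesis using assms(1) by (intro ccI[of _ r] pderivs_zero_outside) (auto simp: smooth_def)
qed

lemma fconv_has_partial:
  assumes "continuous_on UNIV h" "smooth \<phi>" "cc \<phi>"
  shows "((\<lambda>t. fconv h (pderivs is \<phi>) (x + t *\<^sub>R axis i 1)) has_vector_derivative
          fconv h (pderivs (i # is) \<phi>) x) (at 0)"
  by (rule fconv_has_line_derivative[OF assms(1) cc_pderivs[OF assms(2,3)] cc_pderivs[OF assms(2,3)]
        smooth_has_partial[OF assms(2)]])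

lemma pderivs_fconv:
  assumes "continuous_on UNIV h" "smooth \<phi>" "cc \<phi>"
  shows "pderivs is (fconv h \<phi>) = fconv h (pderivs is \<phi>)"
proof (induction "is")
  case (Cons i js)
  show ?case
    unfolding pderivs.simps(2)[of _ _ "fconv h \<phi>"] Cons.IH
    by (rule ext) (simp add: partial_def vector_derivative_at[OF fconv_has_partial[OF assms]] del: pderivs.simps)
qed simp

lemma smooth_fconv:
  assumes "continuous_on UNIV h" "smooth \<phi>" "cc \<phi>"
  shows "smooth (fconv h \<phi>)"
  unfolding smooth_def pderivs_fconv[OF assms]
  by (intro allI conjI fconv_continuous cc_pderivs assms differentiableI_vector[OF fconv_has_partial[OF assms]])

section \<open>Affine substitutions and weighted bounds for convolutions\<close>

lemma lborel_integral_affine: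
  fixes F :: "'a::euclidean_space \<Rightarrow> 'b::{banach,second_countable_topology}"
  assumes "c \<noteq> 0" "F \<in> borel_measurable borel"
  shows "integral\<^sup>L lborel F = \<bar>c\<bar> ^ DIM('a) *\<^sub>R (\<integral>x. F (t + c *\<^sub>R x) \<partial>lborel)"
proof -
  have "integral\<^sup>L lborel F = integral\<^sup>L (density (distr lborel borel (\<lambda>x. t + c *\<^sub>R x)) (\<lambda>_. \<bar>c\<bar>^DIM('a))) F"
    by (subst lborel_affine[OF assms(1), of t]) simp
  also have "\<dots> = (\<integral>x. \<bar>c\<bar>^DIM('a) *\<^sub>R F x \<partial>distr lborel borel (\<lambda>x. t + c *\<^sub>R x))"
    using assms(2) by (subst integral_density) auto
  also have "\<dots> = (\<integral>x. \<bar>c\<bar>^DIM('a) *\<^sub>R F (t + c *\<^sub>R x) \<partial>lborel)"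
    using assms(2) by (subst integral_distr) auto
  finally show ?thesis by simp
qed

lemma lborel_integral_reflect_shift:
  fixes F :: "'a::euclidean_space \<Rightarrow> 'b::{banach,second_countable_topology}"
  assumes "F \<in> borel_measurable borel"
  shows "(\<integral>y. F (x - y) \<partial>lborel) = integral\<^sup>L lborel F"
  using lborel_integral_affine[of "-1" F x] assms by simp

lemma lborel_integral_shift:
  fixes F :: "'a::euclidean_space \<Rightarrow> 'b::{banach,second_countable_topology}"
  assumes "F \<in> borel_measurable borel"
  shows "(\<integral>y. F (x + y) \<partial>lborel) = integral\<^sup>L lborel F"
  using lborel_integral_affine[of 1 F x] assms by simp

lemma fconv_commute:
  assumes "continuous_on UNIV f" "continuous_on UNIV g"
  shows "fconv f g = fconv g f"
proof
  fix x
  have "continuous_on UNIV (\<lambda>y. g (x - y))"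
    by (rule continuous_on_compose2[OF assms(2)]) (auto intro!: continuous_intros)
  then have "(\<lambda>y. f y * g (x - y)) \<in> borel_measurable borel"
    by (intro borel_measurable_continuous_UNIV continuous_on_mult assms)
  from lborel_integral_reflect_shift[OF this, of x]
  show "fconv f g x = fconv g f x" by (simp add: fconv_def mult.commute)
qed

text \<open>The weight is submultiplicative, 1 + |x| \<le> (1 + |y|)(1 + |x - y|), so it can be
  split between the factors: one is measured in weighted sup norm, the other in weighted
  L^1.\<close>

lemma norm_fconv_weighted_le:
  fixes q f :: "real^'d::finite \<Rightarrow> complex"
  assumes f: "\<And>y. (1 + norm y) ^ N * cmod (f y) \<le> S"
    and q: "integrable lborel (\<lambda>y. (1 + norm y) ^ N * cmod (q y))"
  shows "(1 + norm x) ^ N * cmod (fconv q f x) \<le> S * (\<integral>y. (1 + norm y) ^ N * cmod (q y) \<partial>lborel)"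
proof -
  have "(1 + norm x) ^ N * cmod (fconv q f x) \<le> (1 + norm x) ^ N * (\<integral>y. cmod (q y * f (x - y)) \<partial>lborel)"
    unfolding fconv_def by (intro mult_left_mono integral_norm_bound) auto
  also have "\<dots> = (\<integral>y. (1 + norm x) ^ N * cmod (q y * f (x - y)) \<partial>lborel)" by simp
  also have "\<dots> \<le> (\<integral>y. S * ((1 + norm y) ^ N * cmod (q y)) \<partial>lborel)"
  proof (rule integral_mono')
    show "integrable lborel (\<lambda>y. S * ((1 + norm y) ^ N * cmod (q y)))"
      using q by (rule integrable_mult_right)
    fix y
    have S: "S \<ge> 0" using order_trans[OF _ f[of 0]] by simp
    then show "0 \<le> S * ((1 + norm y) ^ N * cmod (q y))" by simp
    have "norm x \<le> norm y + norm (x - y)" by norm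
    moreover have "0 \<le> norm y * norm (x - y)" by simp
    ultimately have "1 + norm x \<le> (1 + norm y) * (1 + norm (x - y))"
      unfolding distrib_left distrib_right by linarith
    then have "(1 + norm x) ^ N \<le> (1 + norm y) ^ N * (1 + norm (x - y)) ^ N"
      unfolding power_mult_distrib[symmetric] by (intro power_mono) auto
    then have "(1 + norm x) ^ N * cmod (q y * f (x - y)) \<le>
        ((1 + norm y) ^ N * (1 + norm (x - y)) ^ N) * cmod (q y * f (x - y))"
      by (intro mult_right_mono) auto
    also have "\<dots> = ((1 + norm (x - y)) ^ N * cmod (f (x - y))) * ((1 + norm y) ^ N * cmod (q y))"
      by (simp add: norm_mult)
    also have "\<dots> \<le> S * ((1 + norm y) ^ N * cmod (q y))"
      by (intro mult_right_mono f) auto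
    finally show "(1 + norm x) ^ N * cmod (q y * f (x - y)) \<le> S * ((1 + norm y) ^ N * cmod (q y))" .
  qed
  also have "\<dots> = S * (\<integral>y. (1 + norm y) ^ N * cmod (q y) \<partial>lborel)" by simp
  finally show ?thesis .
qed

lemma cc_weighted_integrable:
  assumes "cc f" shows "integrable lborel (\<lambda>y. (1 + norm y) ^ N * cmod (f y))"
proof -
  have "cc (\<lambda>y. complex_of_real ((1 + norm y) ^ N) * f y)"
    by (intro cc_times assms continuous_intros)
  from integrable_norm[OF integrable_cc[OF this]]
  show ?thesis by (simp add: norm_mult norm_power del: of_real_power of_real_add)
qed

lemma cc_weighted_bounded:
  assumes "cc f" shows "\<exists>S>0. \<forall>y. (1 + norm y) ^ N * cmod (f y) \<le> S"
proof -
  have "cc (\<lambda>y. complex_of_real ((1 + norm y) ^ N) * f y)"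
    by (intro cc_times assms continuous_intros)
  from cc_bounded[OF this]
  show ?thesis by (simp add: norm_mult norm_power del: of_real_power of_real_add)
qed

text \<open>Commuting the factors puts the differentiated \<open>\<phi>\<close> in the L^1 position
  and leaves for \<open>h\<close> a sup bound free of derivatives. The estimate is pointwise, so it
  yields both boundedness and a bound on the supremum in \<open>seminorm\<close>.\<close>

lemma seminorm_fconv_le:
  assumes h: "continuous_on UNIV h" and \<phi>: "smooth \<phi>" "cc \<phi>"
    and S: "\<And>y. (1 + norm y) ^ N * cmod (h y) \<le> S"
  shows "(1 + norm x) ^ N * cmod (pderivs is (fconv h \<phi>) x)
      \<le> S * (\<integral>y. (1 + norm y) ^ N * cmod (pderivs is \<phi> y) \<partial>lborel)"
proof -
  have c: "cc (pderivs is \<phi>)" by (rule cc_pderivs[OF \<phi>])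
  show ?thesis
    unfolding pderivs_fconv[OF h \<phi>] fconv_commute[OF h cc_continuous[OF c]]
    by (rule norm_fconv_weighted_le[OF S cc_weighted_integrable[OF c]])
qed

lemma schwartz_fconv:
  assumes h: "continuous_on UNIV h" and \<phi>: "smooth \<phi>" "cc \<phi>"
    and S: "\<And>N. \<exists>S. \<forall>y. (1 + norm y) ^ N * cmod (h y) \<le> S"
  shows "schwartz (fconv h \<phi>)"
  unfolding schwartz_def
proof (intro conjI allI smooth_fconv h \<phi>)
  fix N "is"
  obtain S where S': "\<And>y. (1 + norm y) ^ N * cmod (h y) \<le> S" using S[of N] by blast
  show "bounded (range (\<lambda>x. (1 + norm x) ^ N * cmod (pderivs is (fconv h \<phi>) x)))"
    unfolding bounded_iff using seminorm_fconv_le[OF h \<phi> S', of _ "is"] by (auto simp: abs_mult)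
qed

subsection \<open>Fourier transform and polarization\<close>

text \<open>The inner radius \<open>s x\<close> may vary with \<open>x\<close> because for a
  convolution integrand the support in one variable moves with the other. The bound
  \<open>s0\<close> then places the joint support in a ball of the product space.\<close>

lemma Fubini_bounded_support:
  fixes F :: "real^'d::finite \<Rightarrow> real^'d \<Rightarrow> complex"
  assumes F: "continuous_on UNIV (\<lambda>p. F (fst p) (snd p))" "\<And>x y. cmod (F x y) \<le> B"
    and supp: "\<And>x y. norm x > r \<Longrightarrow> F x y = 0" "\<And>x y. norm y > s x \<Longrightarrow> F x y = 0"
    and s: "\<And>x. norm x \<le> r \<Longrightarrow> s x \<le> s0"
  shows "(\<integral>x. \<integral>y. F x y \<partial>lborel \<partial>lborel) = (\<integral>y. \<integral>x. F x y \<partial>lborel \<partial>lborel)"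
proof -
  have meas: "(\<lambda>p. F (fst p) (snd p)) \<in> borel_measurable borel"
    by (rule borel_measurable_continuous_UNIV[OF F(1)])
  have zero: "F (fst p) (snd p) = 0" if "norm p > \<bar>r\<bar> + \<bar>s0\<bar>" for p
  proof -
    have "norm p \<le> norm (fst p) + norm (snd p)"
      using norm_triangle_ineq[of "(fst p, 0)" "(0, snd p)"] by simp
    then consider "norm (fst p) > r" | "norm (fst p) \<le> r" "norm (snd p) > s0"
      using \<open>norm p > \<bar>r\<bar> + \<bar>s0\<bar>\<close> by linarith
    then show ?thesis
    proof cases
      case 2
      then show ?thesis using s[of "fst p"] by (intro supp(2)) linarith
    qed (rule supp(1))
  qed
  have "integrable (lborel :: ((real^'d) \<times> (real^'d)) measure) (\<lambda>p. F (fst p) (snd p))"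
    by (rule integrable_bounded_support[OF _ emeasure_lborel_cball_less_top meas F(2) zero]) auto
  then have "integrable (lborel \<Otimes>\<^sub>M lborel) (case_prod F)"
    by (simp add: lborel_prod case_prod_unfold)
  then show ?thesis by (rule lborel_pair.Fubini_integral[symmetric])
qed

lemma integrable_times_cis:
  fixes f :: "real^'d::finite \<Rightarrow> complex"
  assumes "integrable lborel f"
  shows "integrable lborel (\<lambda>x. f x * cis (2 * pi * (x \<bullet> y)))"
proof (rule Bochner_Integration.integrable_bound[OF assms])
  have "(\<lambda>x. cis (2 * pi * (x \<bullet> y))) \<in> borel_measurable lborel"
    using borel_measurable_continuous_UNIV[of "\<lambda>x. cis (2 * pi * (x \<bullet> y))"]
    by (simp add: continuous_intros)
  then show "(\<lambda>x. f x * cis (2 * pi * (x \<bullet> y))) \<in> borel_measurable lborel"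
    using assms by (intro borel_measurable_times) auto
qed (simp add: norm_mult)

lemma fcheck_norm_le:
  "cmod (fcheck f y) \<le> (\<integral>x. cmod (f x) \<partial>lborel)"
  unfolding fcheck_def
  by (rule order_trans[OF integral_norm_bound]) (simp add: norm_mult)

lemma fcheck_continuous:
  fixes f :: "real^'d::finite \<Rightarrow> complex"
  assumes "integrable lborel f"
  shows "continuous_on UNIV (fcheck f)"
proof -
  have "((\<lambda>y. fcheck f y) \<longlongrightarrow> fcheck f a) (at a)" for a
    unfolding fcheck_def
  proof (rule tendsto_integral_dominated[where w = "\<lambda>x. cmod (f x)"])
    show "((\<lambda>y. f x * cis (2 * pi * (x \<bullet> y))) \<longlongrightarrow> f x * cis (2 * pi * (x \<bullet> a))) (at a)" for x
    proof -
      have "continuous_on UNIV (\<lambda>y. f x * cis (2 * pi * (x \<bullet> y)))" by (intro continuous_intros)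
      then show ?thesis unfolding continuous_on_def by (metis UNIV_I)
    qed
    show "\<forall>\<^sub>F y in at a. \<forall>x. cmod (f x * cis (2 * pi * (x \<bullet> y))) \<le> cmod (f x)"
      by (simp add: norm_mult)
  qed (use integrable_times_cis[OF assms] assms in auto)
  then show ?thesis by (auto simp: continuous_on_def)
qed

lemma fcheck_add:
  "integrable lborel f \<Longrightarrow> integrable lborel g \<Longrightarrow> fcheck (\<lambda>x. f x + g x) y = fcheck f y + fcheck g y"
  unfolding fcheck_def distrib_right
  by (intro Bochner_Integration.integral_add integrable_times_cis)

lemma fcheck_cmult: "fcheck (\<lambda>x. a * f x) y = a * fcheck f y"
  by (simp add: fcheck_def mult.assoc)

lemma fcheck_fconv:
  fixes f g :: "real^'d::finite \<Rightarrow> complex"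
  assumes f: "cc f" and g: "cc g"
  shows "fcheck (fconv f g) \<xi> = fcheck f \<xi> * fcheck g \<xi>"
proof -
  obtain r where r: "r > 0" "\<And>y. norm y > r \<Longrightarrow> f y = 0" using cc_support[OF f] by blast
  obtain s where s: "s > 0" "\<And>y. norm y > s \<Longrightarrow> g y = 0" using cc_support[OF g] by blast
  obtain A where A: "A > 0" "\<And>x. cmod (f x) \<le> A" using cc_bounded[OF f] by blast
  obtain B where B: "B > 0" "\<And>x. cmod (g x) \<le> B" using cc_bounded[OF g] by blast
  define F where "F y x = f y * g (x - y) * cis (2 * pi * (x \<bullet> \<xi>))" for x y
  have "fcheck (fconv f g) \<xi> = (\<integral>x. \<integral>y. F y x \<partial>lborel \<partial>lborel)"
    by (simp add: fcheck_def fconv_def F_def)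
  also have "\<dots> = (\<integral>y. \<integral>x. F y x \<partial>lborel \<partial>lborel)"
  proof (rule Fubini_bounded_support[symmetric, where B = "A * B" and r = r and s = "\<lambda>y. norm y + s" and ?s0.0 = "r + s"])
    have "continuous_on UNIV (\<lambda>p::(real^'d) \<times> (real^'d). f (fst p))"
      by (rule continuous_on_compose2[OF cc_continuous[OF f]]) (auto intro!: continuous_intros)
    moreover have "continuous_on UNIV (\<lambda>p::(real^'d) \<times> (real^'d). g (snd p - fst p))"
      by (rule continuous_on_compose2[OF cc_continuous[OF g]]) (auto intro!: continuous_intros)
    ultimately show "continuous_on UNIV (\<lambda>p. F (fst p) (snd p))"
      unfolding F_def by (intro continuous_intros)
    show "cmod (F y x) \<le> A * B" for y x
      using A B by (simp add: F_def norm_mult mult_mono)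
    show "F y x = 0" if "norm y > r" for y x using r that by (simp add: F_def)
    show "F y x = 0" if "norm x > norm y + s" for y x
    proof -
      have "norm (x - y) > s" using that norm_triangle_ineq2[of x y] by linarith
      then show ?thesis using s by (simp add: F_def)
    qed
  qed simp
  also have "\<dots> = (\<integral>y. f y * cis (2 * pi * (y \<bullet> \<xi>)) * fcheck g \<xi> \<partial>lborel)"
  proof (rule Bochner_Integration.integral_cong[OF refl])
    fix y
    have "(\<lambda>x. g x * cis (2 * pi * ((y + x) \<bullet> \<xi>))) \<in> borel_measurable borel"
      by (intro borel_measurable_continuous_UNIV continuous_intros cc_continuous g)
    from lborel_integral_shift[OF this, of "- y"]
    have "(\<integral>x. g (x - y) * cis (2 * pi * (x \<bullet> \<xi>)) \<partial>lborel) = (\<integral>x. g x * cis (2 * pi * ((y + x) \<bullet> \<xi>)) \<partial>lborel)"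
      by simp
    also have "\<dots> = (\<integral>x. cis (2 * pi * (y \<bullet> \<xi>)) * (g x * cis (2 * pi * (x \<bullet> \<xi>))) \<partial>lborel)"
      by (simp add: inner_add_left distrib_left cis_mult[symmetric] mult_ac)
    also have "\<dots> = cis (2 * pi * (y \<bullet> \<xi>)) * fcheck g \<xi>"
      unfolding fcheck_def by (rule integral_mult_right_zero)
    finally show "(\<integral>x. F y x \<partial>lborel) = f y * cis (2 * pi * (y \<bullet> \<xi>)) * fcheck g \<xi>"
      by (simp add: F_def mult.assoc)
  qed
  also have "\<dots> = fcheck f \<xi> * fcheck g \<xi>"
    unfolding fcheck_def[of f] by (rule integral_mult_left_zero)
  finally show ?thesis .
qed

lemma cc_tilde:
  assumes "cc f" shows "cc (tilde f)"
proof -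
  obtain r where "\<And>y. norm y > r \<Longrightarrow> f y = 0" using cc_support[OF assms] by blast
  moreover have "continuous_on UNIV (\<lambda>x. f (- x))"
    by (rule continuous_on_compose2[OF cc_continuous[OF assms]]) (auto intro!: continuous_intros)
  ultimately show ?thesis unfolding tilde_def[abs_def]
    by (intro ccI[of _ r] continuous_on_cnj) auto
qed

lemma fcheck_tilde: "fcheck (tilde f) y = cnj (fcheck f y)" if "continuous_on UNIV f"
proof -
  have "(\<lambda>x. f x * cis (2 * pi * (x \<bullet> y))) \<in> borel_measurable borel"
    by (intro borel_measurable_continuous_UNIV continuous_intros that)
  from lborel_integral_reflect_shift[OF this, of 0]
  have "fcheck f y = (\<integral>x. f (- x) * cis (- (2 * pi * (x \<bullet> y))) \<partial>lborel)"
    by (simp add: fcheck_def)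
  then have "cnj (fcheck f y) = (\<integral>x. cnj (f (- x) * cis (- (2 * pi * (x \<bullet> y)))) \<partial>lborel)"
    by (simp only: Bochner_Integration.integral_cnj)
  then show ?thesis by (simp add: fcheck_def tilde_def cis_cnj)
qed

section \<open>Integration against Radon measures, and polarization\<close>

lemma radon_integrable_cc:
  assumes "radon m" "cc f"
  shows "integrable (fst m) (\<lambda>x. f x * snd m x)"
proof -
  obtain r where r: "\<And>y. norm y > r \<Longrightarrow> f y = 0" using cc_support[OF assms(2)] by blast
  obtain A where A: "\<And>x. cmod (f x) \<le> A" using cc_bounded[OF assms(2)] by blast
  have m: "sets (fst m) = sets borel" "emeasure (fst m) (cball 0 r) < \<infinity>"
    "snd m \<in> borel_measurable borel" "\<And>x. cmod (snd m x) = 1"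
    using assms(1) by (auto simp: radon_def)
  have "f \<in> borel_measurable borel"
    by (rule borel_measurable_continuous_UNIV[OF cc_continuous[OF assms(2)]])
  then have "(\<lambda>x. f x * snd m x) \<in> borel_measurable borel"
    using m(3) by (rule borel_measurable_times)
  then show ?thesis
    by (rule integrable_bounded_support[OF m(1,2), of _ A]) (use m(4) A r in \<open>auto simp: norm_mult\<close>)
qed

lemma radon_integrable_density:
  assumes "radon m" "integrable (fst m) f"
  shows "integrable (fst m) (\<lambda>x. f x * snd m x)"
proof (rule Bochner_Integration.integrable_bound[OF assms(2)])
  have "snd m \<in> borel_measurable (fst m)"
    using assms(1) by (auto simp: radon_def cong: measurable_cong_sets)
  then show "(\<lambda>x. f x * snd m x) \<in> borel_measurable (fst m)"
    using assms(2) by (intro borel_measurable_times) auto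
qed (use assms in \<open>auto simp: norm_mult radon_def\<close>)

lemma mapply_add:
  assumes "integrable (fst m) (\<lambda>x. f x * snd m x)" "integrable (fst m) (\<lambda>x. g x * snd m x)"
  shows "mapply m (\<lambda>x. f x + g x) = mapply m f + mapply m g"
  unfolding mapply_def distrib_right by (rule Bochner_Integration.integral_add[OF assms])

lemma mapply_cmult: "mapply m (\<lambda>x. a * f x) = a * mapply m f"
  by (simp add: mapply_def mult.assoc)

lemma fconv_sesquilinear:
  fixes f g :: "real^'d::finite \<Rightarrow> complex"
  assumes "cc f" "cc g"
  shows "fconv (\<lambda>x. f x + c * g x) (tilde (\<lambda>x. f x + c * g x)) =
    (\<lambda>x. (fconv f (tilde f) x + cnj c * fconv f (tilde g) x) +
         (c * fconv g (tilde f) x + (c * cnj c) * fconv g (tilde g) x))"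
proof
  fix x :: "real^'d"
  have t: "tilde (\<lambda>x. f x + c * g x) = (\<lambda>x. tilde f x + cnj c * tilde g x)"
    by (simp add: tilde_def fun_eq_iff)
  have int: "integrable lborel (\<lambda>y. p y * tilde q (x - y))" if "cc p" "cc q" for p q
    by (rule fconv_integrable[OF cc_continuous[OF that(1)] cc_tilde[OF that(2)]])
  have "fconv (\<lambda>x. f x + c * g x) (tilde (\<lambda>x. f x + c * g x)) x =
    (\<integral>y. (f y * tilde f (x - y) + cnj c * (f y * tilde g (x - y))) +
       (c * (g y * tilde f (x - y)) + (c * cnj c) * (g y * tilde g (x - y))) \<partial>lborel)"
    unfolding fconv_def t by (simp add: algebra_simps)
  also have "\<dots> = (fconv f (tilde f) x + cnj c * fconv f (tilde g) x) +
         (c * fconv g (tilde f) x + (c * cnj c) * fconv g (tilde g) x)"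
    unfolding fconv_def
    by (subst Bochner_Integration.integral_add integral_mult_right_zero;
        (intro Bochner_Integration.integrable_add integrable_mult_right int assms)?)+ (rule refl)
  finally show "fconv (\<lambda>x. f x + c * g x) (tilde (\<lambda>x. f x + c * g x)) x = \<dots>" .
qed

text \<open>Each bracket is literally the expansion of a sesquilinear form at f + c g for c = 1, -1,
  i, -i; it is left unsimplified so that it can be rewritten with these expansions. Weighted by c,
  only the \<open>B\<close> terms survive, since c, c^2 and c |c|^2 sum to 0 while c times its
  conjugate sums to 4.\<close>

lemma polarization_identity:
  fixes A B C D :: complex
  shows "(A + cnj 1 * B + (1 * C + 1 * cnj 1 * D)) * 1 + (A + cnj (-1) * B + ((-1) * C + (-1) * cnj (-1) * D)) * (-1)
     + (A + cnj \<i> * B + (\<i> * C + \<i> * cnj \<i> * D)) * \<i> + (A + cnj (-\<i>) * B + ((-\<i>) * C + (-\<i>) * cnj (-\<i>) * D)) * (-\<i>) = 4 * B"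
  by (simp add: algebra_simps)

text \<open>Both sides of the defining identity are sesquilinear forms in (f, g) that agree on the
  diagonal. On the Fourier side the mixed terms are integrable because a b \<le> a^2 + b^2 and both
  transforms are in L^2.\<close>

lemma ft_pair_polarized:
  fixes f g :: "real^'d::finite \<Rightarrow> complex"
  assumes ft: "ft_pair mu muh" and f: "cc f" and g: "cc g"
  shows "mapply mu (fconv f (tilde g)) = mapply muh (\<lambda>y. fcheck f y * cnj (fcheck g y))"
    and "integrable (fst muh) (\<lambda>y. fcheck f y * cnj (fcheck g y))"
proof -
  have rad: "radon mu" "radon muh"
    and L2: "\<And>f. cc f \<Longrightarrow> in_L2 muh (fcheck f)"
    and eq: "\<And>f. cc f \<Longrightarrow> mapply mu (fconv f (tilde f)) = mapply muh (\<lambda>y. complex_of_real ((cmod (fcheck f y))^2))"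
    using ft by (auto simp: ft_pair_def)
  have int: "integrable (fst muh) (\<lambda>y. fcheck p y * cnj (fcheck q y))" if "cc p" "cc q" for p q
  proof (rule Bochner_Integration.integrable_bound)
    show "integrable (fst muh) (\<lambda>y. (cmod (fcheck p y))\<^sup>2 + (cmod (fcheck q y))\<^sup>2)"
      using L2 that by (intro Bochner_Integration.integrable_add) (auto simp: in_L2_def)
    have "fcheck p \<in> borel_measurable (fst muh)" "fcheck q \<in> borel_measurable (fst muh)"
      using L2 that by (auto simp: in_L2_def)
    then show "(\<lambda>y. fcheck p y * cnj (fcheck q y)) \<in> borel_measurable (fst muh)"
      by (intro borel_measurable_times) (auto intro: borel_measurable_continuous_on[OF continuous_on_cnj[OF continuous_on_id]])
    have "a * b \<le> a\<^sup>2 + b\<^sup>2" if "a \<ge> 0" "b \<ge> 0" for a b :: real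
      using sum_squares_bound[of a b] mult_nonneg_nonneg[OF that] by linarith
    then show "AE y in fst muh. cmod (fcheck p y * cnj (fcheck q y)) \<le> norm ((cmod (fcheck p y))\<^sup>2 + (cmod (fcheck q y))\<^sup>2)"
      by (intro AE_I2) (simp add: norm_mult)
  qed
  show "integrable (fst muh) (\<lambda>y. fcheck f y * cnj (fcheck g y))" by (rule int[OF f g])
  let ?M = "\<lambda>p q. mapply mu (fconv p (tilde q))"
  let ?N = "\<lambda>p q. mapply muh (\<lambda>y. fcheck p y * cnj (fcheck q y))"
  have M: "?M (\<lambda>x. f x + c * g x) (\<lambda>x. f x + c * g x) = (?M f f + cnj c * ?M f g) + (c * ?M g f + c * cnj c * ?M g g)" for c
  proof -
    have i: "integrable (fst mu) (\<lambda>x. (a * fconv p (tilde q) x) * snd mu x)" if "cc p" "cc q" for a p q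
      by (intro radon_integrable_cc rad cc_cmult cc_fconv cc_tilde that)
    have i1: "integrable (fst mu) (\<lambda>x. fconv p (tilde q) x * snd mu x)" if "cc p" "cc q" for p q
      by (intro radon_integrable_cc rad cc_fconv cc_tilde that)
    have i2: "integrable (fst mu) (\<lambda>x. (u x + v x) * snd mu x)"
      if "integrable (fst mu) (\<lambda>x. u x * snd mu x)" "integrable (fst mu) (\<lambda>x. v x * snd mu x)" for u v
      unfolding distrib_right by (rule Bochner_Integration.integrable_add[OF that])
    show ?thesis unfolding fconv_sesquilinear[OF f g]
      by (simp only: mapply_add mapply_cmult i i1 i2 f g)
  qed
  have N: "?N (\<lambda>x. f x + c * g x) (\<lambda>x. f x + c * g x) = (?N f f + cnj c * ?N f g) + (c * ?N g f + c * cnj c * ?N g g)" for c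
  proof -
    have i1: "integrable (fst muh) (\<lambda>y. fcheck p y * cnj (fcheck q y) * snd muh y)" if "cc p" "cc q" for p q
      by (intro radon_integrable_density rad int that)
    have i: "integrable (fst muh) (\<lambda>y. (a * (fcheck p y * cnj (fcheck q y))) * snd muh y)" if "cc p" "cc q" for a p q
      by (intro radon_integrable_density rad integrable_mult_right int that)
    have i2: "integrable (fst muh) (\<lambda>x. (u x + v x) * snd muh x)"
      if "integrable (fst muh) (\<lambda>x. u x * snd muh x)" "integrable (fst muh) (\<lambda>x. v x * snd muh x)" for u v
      unfolding distrib_right by (rule Bochner_Integration.integrable_add[OF that])
    have "fcheck (\<lambda>x. f x + c * g x) y = fcheck f y + c * fcheck g y" for y
      by (simp add: fcheck_add fcheck_cmult integrable_cc f g)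
    then have "(\<lambda>y. fcheck (\<lambda>x. f x + c * g x) y * cnj (fcheck (\<lambda>x. f x + c * g x) y)) =
      (\<lambda>y. (fcheck f y * cnj (fcheck f y) + cnj c * (fcheck f y * cnj (fcheck g y))) +
         (c * (fcheck g y * cnj (fcheck f y)) + c * cnj c * (fcheck g y * cnj (fcheck g y))))"
      by (simp add: algebra_simps)
    then show ?thesis
      by (simp only: mapply_add mapply_cmult i i1 i2 f g)
  qed
  have Q: "?M (\<lambda>x. f x + c * g x) (\<lambda>x. f x + c * g x) = ?N (\<lambda>x. f x + c * g x) (\<lambda>x. f x + c * g x)" for c
    using eq[OF cc_add[OF f cc_cmult[OF g]], of c] by (simp only: complex_norm_square)
  have "4 * ?M f g = 4 * ?N f g"
    unfolding polarization_identity[of "?M f f" "?M f g" "?M g f" "?M g g", symmetric]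
      polarization_identity[of "?N f f" "?N f g" "?N g f" "?N g g", symmetric]
    by (simp only: M[symmetric] N[symmetric] Q)
  then show "?M f g = ?N f g" by simp
qed

subsection \<open>Rapid decay and Fourier inversion\<close>

lemma fcheck_line_derivative:
  fixes \<psi> :: "real^'d::finite \<Rightarrow> complex"
  assumes \<psi>: "cc \<psi>" and \<psi>': "cc \<psi>'"
    and der: "\<And>x. ((\<lambda>t. \<psi> (x + t *\<^sub>R e)) has_vector_derivative \<psi>' x) (at 0)"
  shows "fcheck \<psi>' y = - (2 * pi * (e \<bullet> y)) * \<i> * fcheck \<psi> y"
proof -
  \<comment> \<open>Convolution with a character is the Fourier transform times a character, so differentiation
     under the integral sign reduces to the case of convolutions.\<close>
  define h where "h z = cis (2 * pi * (- z \<bullet> y))" for z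
  have h: "continuous_on UNIV h" unfolding h_def by (intro continuous_intros)
  have conv: "fconv h p x = cis (- (2 * pi * (x \<bullet> y))) * fcheck p y" if "cc p" for p x
  proof -
    have "(\<lambda>z. h z * p (x - z)) \<in> borel_measurable borel"
      using fconv_integrand_measurable[OF h that] by simp
    from lborel_integral_reflect_shift[OF this, of x]
    have "fconv h p x = (\<integral>z. h (x - z) * p z \<partial>lborel)" by (simp add: fconv_def)
    also have "\<dots> = (\<integral>z. cis (- (2 * pi * (x \<bullet> y))) * (p z * cis (2 * pi * (z \<bullet> y))) \<partial>lborel)"
    proof (rule Bochner_Integration.integral_cong[OF refl])
      fix z
      have hz: "h (x - z) = cis (- (2 * pi * (x \<bullet> y)) + 2 * pi * (z \<bullet> y))"
        by (simp add: h_def inner_diff_left algebra_simps)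
      show "h (x - z) * p z = cis (- (2 * pi * (x \<bullet> y))) * (p z * cis (2 * pi * (z \<bullet> y)))"
        unfolding hz cis_mult[symmetric] by (simp only: mult_ac)
    qed
    finally show ?thesis by (simp add: fcheck_def)
  qed
  have "((\<lambda>t. fconv h \<psi> (0 + t *\<^sub>R e)) has_vector_derivative fconv h \<psi>' 0) (at 0)"
    by (rule fconv_has_line_derivative[OF h \<psi> \<psi>' der])
  then have 1: "((\<lambda>t. cis (- (2 * pi * (e \<bullet> y)) * t) * fcheck \<psi> y) has_vector_derivative fcheck \<psi>' y) (at 0)"
    by (simp add: conv \<psi> \<psi>' mult_ac)
  define a where "a = - (2 * pi * (e \<bullet> y))"
  have "((\<lambda>t. exp (of_real t * (\<i> * of_real a))) has_vector_derivative (\<i> * of_real a) * exp (of_real 0 * (\<i> * of_real a))) (at (0::real))"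
    using exp_scaleR_has_vector_derivative_left[of "\<i> * of_real a" 0] by (simp add: scaleR_conv_of_real)
  moreover have "exp (of_real t * (\<i> * of_real a)) = cis (a * t)" for t
    by (simp add: cis_conv_exp mult_ac)
  ultimately have "((\<lambda>t. cis (a * t)) has_vector_derivative (\<i> * of_real a)) (at 0)" by simp
  then have 2: "((\<lambda>t. cis (a * t) * fcheck \<psi> y) has_vector_derivative (\<i> * of_real a) * fcheck \<psi> y) (at 0)"
    by (rule has_vector_derivative_mult_left)
  \<comment> \<open>\<open>1\<close> and \<open>2\<close> differentiate the same function of
    \<open>t\<close>, once under the convolution integral and once directly.\<close>
  show ?thesis
    using vector_derivative_unique_at[OF 1[folded a_def] 2] by (simp add: a_def)
qed

lemma cmod_fcheck_pderivs_replicate: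
  assumes "smooth w" "cc w"
  shows "cmod (fcheck (pderivs (replicate N i) w) y) = (2 * pi * \<bar>y $ i\<bar>) ^ N * cmod (fcheck w y)"
proof (induction N)
  case (Suc N)
  have "fcheck (pderivs (i # replicate N i) w) y =
      - (2 * pi * (axis i 1 \<bullet> y)) * \<i> * fcheck (pderivs (replicate N i) w) y"
    by (rule fcheck_line_derivative[OF cc_pderivs[OF assms] cc_pderivs[OF assms] smooth_has_partial[OF assms(1)]])
  then show ?case using Suc.IH
    by (simp add: norm_mult inner_axis' abs_mult del: pderivs.simps)
qed simp

text \<open>Reduces the weight to pure powers of single coordinates, so that only repeated
  derivatives in one direction are needed for decay. The largest coordinate controls the norm up to
  the factor \<open>CARD('d)\<close>.\<close>

lemma weight_le_sum_powers:
  fixes y :: "real^'d::finite"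
  shows "(1 + norm y) ^ N \<le> (1 + real CARD('d)) ^ N * (1 + (\<Sum>j\<in>UNIV. \<bar>y $ j\<bar> ^ N))"
proof -
  obtain i where i: "\<And>j. \<bar>y $ j\<bar> \<le> \<bar>y $ i\<bar>"
  proof -
    have "Max (range (\<lambda>j. \<bar>y $ j\<bar>)) \<in> range (\<lambda>j. \<bar>y $ j\<bar>)" by (rule Max_in) auto
    then obtain i where "Max (range (\<lambda>j. \<bar>y $ j\<bar>)) = \<bar>y $ i\<bar>" by blast
    then show ?thesis using that[of i] by (metis Max_ge finite finite_imageI rangeI)
  qed
  define m where "m = max 1 \<bar>y $ i\<bar>"
  have "norm y \<le> (\<Sum>j\<in>UNIV. \<bar>y $ j\<bar>)" by (rule norm_le_l1_cart)
  also have "\<dots> \<le> (\<Sum>j\<in>(UNIV::'d set). m)"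
    by (intro sum_mono) (use i in \<open>auto simp: m_def intro: order_trans max.coboundedI2\<close>)
  also have "\<dots> = CARD('d) * m" by simp
  finally have "1 + norm y \<le> (1 + real CARD('d)) * m"
    by (simp add: m_def algebra_simps)
  then have "(1 + norm y) ^ N \<le> (1 + real CARD('d)) ^ N * m ^ N"
    unfolding power_mult_distrib[symmetric] by (intro power_mono) auto
  also have "m ^ N \<le> 1 + \<bar>y $ i\<bar> ^ N" by (auto simp: m_def max_def)
  also have "\<bar>y $ i\<bar> ^ N \<le> (\<Sum>j\<in>UNIV. \<bar>y $ j\<bar> ^ N)"
    by (rule member_le_sum) auto
  finally show ?thesis by (simp add: mult_left_mono)
qed

lemma fcheck_rapid_decay:
  fixes w :: "real^'d::finite \<Rightarrow> complex"
  assumes "smooth w" "cc w"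
  shows "\<exists>C. \<forall>y. (1 + norm y) ^ N * cmod (fcheck w y) \<le> C"
proof -
  define I where "I i = (\<integral>x. cmod (pderivs (replicate N i) w x) \<partial>lborel)" for i
  define I0 where "I0 = (\<integral>x. cmod (w x) \<partial>lborel)"
  have I: "\<bar>y $ i\<bar> ^ N * cmod (fcheck w y) \<le> I i" for i y
  proof -
    have "\<bar>y $ i\<bar> \<le> 2 * pi * \<bar>y $ i\<bar>"
      using pi_ge_two mult_right_mono[of 1 "2 * pi" "\<bar>y $ i\<bar>"] by simp
    then have "\<bar>y $ i\<bar> ^ N * cmod (fcheck w y) \<le> (2 * pi * \<bar>y $ i\<bar>) ^ N * cmod (fcheck w y)"
      by (intro mult_right_mono power_mono) auto
    also have "\<dots> \<le> I i"
      unfolding cmod_fcheck_pderivs_replicate[OF assms, symmetric] I_def by (rule fcheck_norm_le)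
    finally show ?thesis .
  qed
  have "(1 + norm y) ^ N * cmod (fcheck w y) \<le> (1 + real CARD('d)) ^ N * (I0 + (\<Sum>j\<in>UNIV. I j))" for y
  proof -
    have "(1 + norm y) ^ N * cmod (fcheck w y) \<le>
        (1 + real CARD('d)) ^ N * (1 + (\<Sum>j\<in>UNIV. \<bar>y $ j\<bar> ^ N)) * cmod (fcheck w y)"
      by (intro mult_right_mono weight_le_sum_powers) auto
    also have "\<dots> = (1 + real CARD('d)) ^ N * (cmod (fcheck w y) + (\<Sum>j\<in>UNIV. \<bar>y $ j\<bar> ^ N * cmod (fcheck w y)))"
      by (simp add: algebra_simps sum_distrib_left)
    also have "\<dots> \<le> (1 + real CARD('d)) ^ N * (I0 + (\<Sum>j\<in>UNIV. I j))"
      unfolding I0_def by (intro mult_left_mono add_mono sum_mono I fcheck_norm_le) auto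
    finally show ?thesis .
  qed
  then show ?thesis by blast
qed

text \<open>On n \<le> |y| < n + 1 the integrand is at most (n + 1)^-(D + 2). Enlarging each shell
  to the full ball, of volume proportional to (n + 1)^D, still leaves the convergent series of (n +
  1)^-2; this fixes the exponent D + 2.\<close>

lemma integrable_inverse_weight:
  "integrable lborel (\<lambda>y::'a::euclidean_space. 1 / (1 + norm y) ^ (DIM('a) + 2))"
proof (rule integrableI_bounded)
  let ?D = "DIM('a)"
  let ?g = "\<lambda>y::'a. 1 / (1 + norm y) ^ (?D + 2)"
  let ?t = "\<lambda>n (y::'a). ennreal (1 / (1 + real n) ^ (?D + 2)) * indicator (ball 0 (real n + 1)) y"
  show "?g \<in> borel_measurable lborel" by measurable
  have le: "ennreal (norm (?g y)) \<le> (\<Sum>n. ?t n y)" for y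
  proof -
    define n where "n = nat \<lfloor>norm y\<rfloor>"
    have n: "real n \<le> norm y" "norm y < real n + 1"
      using floor_correct[of "norm y"] by (simp_all add: n_def)
    have "norm (?g y) \<le> 1 / (1 + real n) ^ (?D + 2)"
      using n by (simp del: power_add power_Suc add: frac_le power_mono)
    then have "ennreal (norm (?g y)) \<le> ?t n y" using n by (simp add: indicator_def ennreal_leI)
    also have "f n \<le> suminf f" for f :: "nat \<Rightarrow> ennreal"
      using sum_le_suminf[of f "{n}"] by (simp add: summableI)
    finally show ?thesis .
  qed
  have int_shell: "(\<integral>\<^sup>+ y. ?t n y \<partial>lborel) = ennreal (unit_ball_vol ?D * (1 / (real n + 1)\<^sup>2))" for n
  proof -
    have "(\<integral>\<^sup>+ y. ?t n y \<partial>lborel) = ennreal (1 / (1 + real n) ^ (?D + 2)) * emeasure lborel (ball (0::'a) (real n + 1))"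
      by (rule nn_integral_cmult_indicator) simp
    also have "\<dots> = ennreal (1 / (1 + real n) ^ (?D + 2) * (unit_ball_vol ?D * (real n + 1) ^ ?D))"
      by (subst emeasure_ball, simp, subst ennreal_mult) auto
    also have "1 / (1 + real n) ^ (?D + 2) * (unit_ball_vol ?D * (real n + 1) ^ ?D) = unit_ball_vol ?D * (1 / (real n + 1)\<^sup>2)"
      by (simp add: power_add power2_eq_square add.commute)
    finally show ?thesis .
  qed
  have "summable (\<lambda>n. 1 / (real n + 1)\<^sup>2)"
    using inverse_power_summable[of 2, where 'a = real] summable_Suc_iff[of "\<lambda>n. inverse (real n ^ 2)"]
    by (simp add: inverse_eq_divide add.commute)
  then have sum: "summable (\<lambda>n. unit_ball_vol ?D * (1 / (real n + 1)\<^sup>2))" by (rule summable_mult)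
  have "(\<integral>\<^sup>+ y. ennreal (norm (?g y)) \<partial>lborel) \<le> (\<integral>\<^sup>+ y. (\<Sum>n. ?t n y) \<partial>lborel)"
    by (intro nn_integral_mono le)
  also have "\<dots> = (\<Sum>n. \<integral>\<^sup>+ y. ?t n y \<partial>lborel)" by (rule nn_integral_suminf) (intro borel_measurable_times_ennreal borel_measurable_indicator, auto)
  also have "\<dots> = (\<Sum>n. ennreal (unit_ball_vol ?D * (1 / (real n + 1)\<^sup>2)))" unfolding int_shell ..
  also have "(\<Sum>n. ennreal (unit_ball_vol ?D * (1 / (real n + 1)\<^sup>2))) \<noteq> top"
    by (rule ennreal_suminf_neq_top[OF sum]) simp
  then have "(\<Sum>n. ennreal (unit_ball_vol ?D * (1 / (real n + 1)\<^sup>2))) < \<infinity>"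
    by (simp only: infinity_ennreal_def less_top)
  finally show "(\<integral>\<^sup>+ y. ennreal (norm (?g y)) \<partial>lborel) < \<infinity>" .
qed

lemma rapid_decay_weighted_integrable:
  fixes k :: "real^'d::finite \<Rightarrow> complex"
  assumes k: "continuous_on UNIV k"
    and decay: "\<And>N. \<exists>C. \<forall>y. (1 + norm y) ^ N * cmod (k y) \<le> C"
  shows "integrable lborel (\<lambda>y. (1 + norm y) ^ N * cmod (k y))"
proof -
  \<comment> \<open>The decay hypothesis is used with \<open>?D\<close> additional powers, which
    supply an integrable factor.\<close>
  let ?D = "DIM(real^'d) + 2"
  obtain C where C: "\<And>y. (1 + norm y) ^ (N + ?D) * cmod (k y) \<le> C" using decay by blast
  show ?thesis
  proof (rule Bochner_Integration.integrable_bound)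
    show "integrable lborel (\<lambda>y::real^'d. C * (1 / (1 + norm y) ^ ?D))"
      by (intro integrable_mult_right integrable_inverse_weight)
    have "(\<lambda>y. (1 + norm y) ^ N * cmod (k y)) \<in> borel_measurable borel"
      by (intro borel_measurable_continuous_onI continuous_intros k)
    then show "(\<lambda>y. (1 + norm y) ^ N * cmod (k y)) \<in> borel_measurable lborel" by simp
    have "(1 + norm y) ^ N * cmod (k y) \<le> C / (1 + norm y) ^ ?D" for y
    proof -
      have "(1 + norm y) ^ ?D > 0" by (rule zero_less_power) (simp add: add_pos_nonneg)
      then show ?thesis using C[of y] by (simp add: pos_le_divide_eq power_add mult_ac)
    qed
    then show "AE y in lborel. norm ((1 + norm y) ^ N * cmod (k y)) \<le> norm (C * (1 / (1 + norm y) ^ ?D))"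
    proof (intro AE_I2)
      fix y
      have "norm ((1 + norm y) ^ N * cmod (k y)) = (1 + norm y) ^ N * cmod (k y)" by simp
      also have "\<dots> \<le> C / (1 + norm y) ^ ?D" by fact
      also have "\<dots> \<le> norm (C * (1 / (1 + norm y) ^ ?D))"
        unfolding times_divide_eq_right mult_1_right real_norm_def by (rule abs_ge_self)
      finally show "norm ((1 + norm y) ^ N * cmod (k y)) \<le> norm (C * (1 / (1 + norm y) ^ ?D))" .
    qed
  qed
qed

lemma rapid_decay_integrable:
  fixes k :: "real^'d::finite \<Rightarrow> complex"
  assumes "continuous_on UNIV k" "\<And>N. \<exists>C. \<forall>y. (1 + norm y) ^ N * cmod (k y) \<le> C"
  shows "integrable lborel k"
proof -
  have "integrable lborel (\<lambda>y. cmod (k y))"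
    using rapid_decay_weighted_integrable[OF assms, of 0] by simp
  then show ?thesis
    by (rule integrable_norm_cancel) (use borel_measurable_continuous_UNIV[OF assms(1)] in simp)
qed

section \<open>Fourier inversion by a summability kernel\<close>

lemma continuous_nonneg_integral_pos:
  fixes g :: "'a::euclidean_space \<Rightarrow> real"
  assumes g: "continuous_on UNIV g" "\<And>x. g x \<ge> 0" "integrable lborel g" and a: "g a > 0"
  shows "integral\<^sup>L lborel g > 0"
proof -
  have "open {x. g x > g a / 2}" by (intro open_Collect_less g continuous_intros)
  moreover have "a \<in> {x. g x > g a / 2}" using a by simp
  ultimately obtain \<delta> where \<delta>: "\<delta> > 0" "ball a \<delta> \<subseteq> {x. g x > g a / 2}"
    unfolding open_contains_ball by blast
  have "0 < g a / 2 * measure lborel (ball a \<delta>)"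
    using a \<delta>(1) by (simp add: content_ball_gt_0_iff)
  also have "\<dots> = (\<integral>x. g a / 2 * indicator (ball a \<delta>) x \<partial>lborel)" by simp
  also have "\<dots> \<le> integral\<^sup>L lborel g"
    by (rule integral_mono'[OF g(3)]) (use \<delta> g(2) in \<open>auto simp: indicator_def\<close>)
  finally show ?thesis .
qed

text \<open>The factor \<open>W (\<epsilon> *\<^sub>R \<xi>)\<close> gives the double integral
  compact support, so Fubini applies. Integrating over \<open>\<xi>\<close> instead of
  \<open>x\<close> produces a rescaled transform of \<open>W\<close>.\<close>

lemma double_fcheck_regularized:
  fixes w W :: "real^'d::finite \<Rightarrow> complex"
  assumes w: "cc w" and W: "cc W" and \<epsilon>: "\<epsilon> > 0"
  shows "(\<integral>\<xi>. fcheck w \<xi> * cis (2 * pi * (\<xi> \<bullet> y)) * W (\<epsilon> *\<^sub>R \<xi>) \<partial>lborel)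
       = (\<integral>z. w (- y + \<epsilon> *\<^sub>R z) * fcheck W z \<partial>lborel)"
proof -
  let ?D = "DIM(real^'d)"
  obtain r where r: "r > 0" "\<And>y. norm y > r \<Longrightarrow> w y = 0" using cc_support[OF w] by blast
  obtain s where s: "s > 0" "\<And>y. norm y > s \<Longrightarrow> W y = 0" using cc_support[OF W] by blast
  obtain A where A: "A > 0" "\<And>x. cmod (w x) \<le> A" using cc_bounded[OF w] by blast
  obtain B where B: "B > 0" "\<And>x. cmod (W x) \<le> B" using cc_bounded[OF W] by blast
  define F where "F x \<xi> = w x * cis (2 * pi * ((x + y) \<bullet> \<xi>)) * W (\<epsilon> *\<^sub>R \<xi>)" for x \<xi>
  have "(\<integral>\<xi>. fcheck w \<xi> * cis (2 * pi * (\<xi> \<bullet> y)) * W (\<epsilon> *\<^sub>R \<xi>) \<partial>lborel) = (\<integral>\<xi>. \<integral>x. F x \<xi> \<partial>lborel \<partial>lborel)"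
  proof (rule Bochner_Integration.integral_cong[OF refl])
    fix \<xi>
    have "(\<integral>x. F x \<xi> \<partial>lborel) = (\<integral>x. (cis (2 * pi * (\<xi> \<bullet> y)) * W (\<epsilon> *\<^sub>R \<xi>)) * (w x * cis (2 * pi * (x \<bullet> \<xi>))) \<partial>lborel)"
      by (simp add: F_def inner_add_left distrib_left cis_mult[symmetric] inner_commute[of \<xi> y] mult_ac)
    also have "\<dots> = cis (2 * pi * (\<xi> \<bullet> y)) * W (\<epsilon> *\<^sub>R \<xi>) * fcheck w \<xi>"
      unfolding fcheck_def by (rule integral_mult_right_zero)
    finally show "fcheck w \<xi> * cis (2 * pi * (\<xi> \<bullet> y)) * W (\<epsilon> *\<^sub>R \<xi>) = (\<integral>x. F x \<xi> \<partial>lborel)"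
      by (simp add: mult_ac)
  qed
  also have "\<dots> = (\<integral>x. \<integral>\<xi>. F x \<xi> \<partial>lborel \<partial>lborel)"
  proof (rule Fubini_bounded_support[symmetric, where B = "A * B" and r = r and s = "\<lambda>y. s / \<epsilon>" and ?s0.0 = "s / \<epsilon>"])
    have "continuous_on UNIV (\<lambda>p::(real^'d) \<times> (real^'d). w (fst p))"
      by (rule continuous_on_compose2[OF cc_continuous[OF w]]) (auto intro!: continuous_intros)
    moreover have "continuous_on UNIV (\<lambda>p::(real^'d) \<times> (real^'d). W (\<epsilon> *\<^sub>R snd p))"
      by (rule continuous_on_compose2[OF cc_continuous[OF W]]) (auto intro!: continuous_intros)
    ultimately show "continuous_on UNIV (\<lambda>p. F (fst p) (snd p))"
      unfolding F_def by (intro continuous_intros)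
    show "cmod (F x \<xi>) \<le> A * B" for x \<xi>
      using A B by (simp add: F_def norm_mult mult_mono)
    show "F x \<xi> = 0" if "norm x > r" for x \<xi> using r that by (simp add: F_def)
    show "F x \<xi> = 0" if "norm \<xi> > s / \<epsilon>" for x \<xi>
    proof -
      have "norm (\<epsilon> *\<^sub>R \<xi>) > s" using that \<epsilon> by (simp add: pos_divide_less_eq mult.commute)
      then show ?thesis using s by (simp add: F_def)
    qed
  qed simp
  also have "\<dots> = (\<integral>x. (1 / \<epsilon> ^ ?D) *\<^sub>R (w x * fcheck W ((1 / \<epsilon>) *\<^sub>R (x + y))) \<partial>lborel)"
  proof (rule Bochner_Integration.integral_cong[OF refl])
    fix x
    let ?G = "\<lambda>\<zeta>. W \<zeta> * cis (2 * pi * (\<zeta> \<bullet> ((1 / \<epsilon>) *\<^sub>R (x + y))))"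
    have "?G \<in> borel_measurable borel"
      by (intro borel_measurable_continuous_UNIV continuous_intros cc_continuous W)
    from lborel_integral_affine[OF _ this, of \<epsilon> 0]
    have "fcheck W ((1 / \<epsilon>) *\<^sub>R (x + y)) = \<epsilon> ^ ?D *\<^sub>R (\<integral>\<zeta>. ?G (\<epsilon> *\<^sub>R \<zeta>) \<partial>lborel)"
      unfolding fcheck_def using \<epsilon> by simp
    also have "(\<integral>\<zeta>. ?G (\<epsilon> *\<^sub>R \<zeta>) \<partial>lborel) = (\<integral>\<xi>. cis (2 * pi * ((x + y) \<bullet> \<xi>)) * W (\<epsilon> *\<^sub>R \<xi>) \<partial>lborel)"
      using \<epsilon> by (simp add: inner_commute mult.commute)
    finally have "(\<integral>\<xi>. cis (2 * pi * ((x + y) \<bullet> \<xi>)) * W (\<epsilon> *\<^sub>R \<xi>) \<partial>lborel) = (1 / \<epsilon> ^ ?D) *\<^sub>R fcheck W ((1 / \<epsilon>) *\<^sub>R (x + y))"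
      using \<epsilon> by simp
    moreover have "(\<integral>\<xi>. F x \<xi> \<partial>lborel) = w x * (\<integral>\<xi>. cis (2 * pi * ((x + y) \<bullet> \<xi>)) * W (\<epsilon> *\<^sub>R \<xi>) \<partial>lborel)"
      unfolding F_def mult.assoc by (rule integral_mult_right_zero)
    ultimately show "(\<integral>\<xi>. F x \<xi> \<partial>lborel) = (1 / \<epsilon> ^ ?D) *\<^sub>R (w x * fcheck W ((1 / \<epsilon>) *\<^sub>R (x + y)))"
      by simp
  qed
  \<comment> \<open>The substitution x = -y + \<open>\<epsilon>\<close> z absorbs the factor 1 /
    \<open>\<epsilon> ^ ?D\<close>.\<close>
  also have "\<dots> = (\<integral>z. w (- y + \<epsilon> *\<^sub>R z) * fcheck W z \<partial>lborel)"
  proof -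
    let ?H = "\<lambda>x. w x * fcheck W ((1 / \<epsilon>) *\<^sub>R (x + y))"
    have "continuous_on UNIV (\<lambda>x. fcheck W ((1 / \<epsilon>) *\<^sub>R (x + y)))"
      by (rule continuous_on_compose2[OF fcheck_continuous[OF integrable_cc[OF W]]]) (auto intro!: continuous_intros)
    then have "?H \<in> borel_measurable borel"
      by (intro borel_measurable_continuous_UNIV continuous_on_mult cc_continuous[OF w])
    from lborel_integral_affine[OF _ this, of \<epsilon> "- y"] show ?thesis using \<epsilon> by simp
  qed
  finally show ?thesis .
qed

text \<open>Limit of the regularized identity as \<open>\<epsilon>\<close> tends to 0. Integrability
  of \<open>fcheck w\<close> dominates the left side and that of \<open>fcheck W\<close> the right
  side, while continuity of \<open>W\<close> at 0 and of \<open>w\<close> at \<open>- y\<close>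
  gives the pointwise limits.\<close>

lemma double_fcheck_times:
  fixes w W :: "real^'d::finite \<Rightarrow> complex"
  assumes w: "cc w" "integrable lborel (fcheck w)" and W: "cc W" "integrable lborel (fcheck W)"
  shows "fcheck (fcheck w) y * W 0 = w (- y) * (\<integral>z. fcheck W z \<partial>lborel)"
proof -
  obtain A where A: "A > 0" "\<And>x. cmod (w x) \<le> A" using cc_bounded[OF w(1)] by blast
  obtain B where B: "B > 0" "\<And>x. cmod (W x) \<le> B" using cc_bounded[OF W(1)] by blast
  define \<epsilon> where "\<epsilon> n = inverse (real (Suc n))" for n
  have \<epsilon>: "\<epsilon> n > 0" "\<epsilon> \<longlonglongrightarrow> 0" for n
    unfolding \<epsilon>_def using LIMSEQ_inverse_real_of_nat by auto
  have lim0: "(\<lambda>n. \<epsilon> n *\<^sub>R z) \<longlonglongrightarrow> 0" for z :: "real^'d"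
    using tendsto_scaleR[OF \<epsilon>(2) tendsto_const[of z]] by simp
  have isC: "isCont p a" if "cc p" for p :: "real^'d \<Rightarrow> complex" and a
    using cc_continuous[OF that] by (simp add: continuous_on_eq_continuous_at)
  have mW: "(\<lambda>\<xi>. W (c *\<^sub>R \<xi>)) \<in> borel_measurable lborel" for c
  proof -
    have "continuous_on UNIV (\<lambda>\<xi>. W (c *\<^sub>R \<xi>))"
      by (rule continuous_on_compose2[OF cc_continuous[OF W(1)]]) (auto intro!: continuous_intros)
    from borel_measurable_continuous_UNIV[OF this] show ?thesis by simp
  qed
  have mw: "(\<lambda>z. w (- y + c *\<^sub>R z)) \<in> borel_measurable lborel" for c
  proof -
    have "continuous_on UNIV (\<lambda>z. w (- y + c *\<^sub>R z))"
      by (rule continuous_on_compose2[OF cc_continuous[OF w(1)]]) (auto intro!: continuous_intros)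
    from borel_measurable_continuous_UNIV[OF this] show ?thesis by simp
  qed
  have L: "(\<lambda>n. \<integral>\<xi>. fcheck w \<xi> * cis (2 * pi * (\<xi> \<bullet> y)) * W (\<epsilon> n *\<^sub>R \<xi>) \<partial>lborel)
      \<longlonglongrightarrow> (\<integral>\<xi>. fcheck w \<xi> * cis (2 * pi * (\<xi> \<bullet> y)) * W 0 \<partial>lborel)"
  proof (rule integral_dominated_convergence[where w = "\<lambda>\<xi>. cmod (fcheck w \<xi>) * B"])
    show "integrable lborel (\<lambda>\<xi>. cmod (fcheck w \<xi>) * B)" using w by auto
    show "AE \<xi> in lborel. (\<lambda>n. fcheck w \<xi> * cis (2 * pi * (\<xi> \<bullet> y)) * W (\<epsilon> n *\<^sub>R \<xi>)) \<longlonglongrightarrow> fcheck w \<xi> * cis (2 * pi * (\<xi> \<bullet> y)) * W 0"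
      by (intro AE_I2 tendsto_mult_left isCont_tendsto_compose[OF isC[OF W(1)]] lim0)
    show "AE \<xi> in lborel. cmod (fcheck w \<xi> * cis (2 * pi * (\<xi> \<bullet> y)) * W (\<epsilon> n *\<^sub>R \<xi>)) \<le> cmod (fcheck w \<xi>) * B" for n
      using B by (intro AE_I2) (simp add: norm_mult mult_left_mono)
    show "(\<lambda>\<xi>. fcheck w \<xi> * cis (2 * pi * (\<xi> \<bullet> y)) * W (\<epsilon> n *\<^sub>R \<xi>)) \<in> borel_measurable lborel" for n
      by (rule borel_measurable_times[OF borel_measurable_integrable[OF integrable_times_cis[OF w(2)]] mW])
    show "(\<lambda>\<xi>. fcheck w \<xi> * cis (2 * pi * (\<xi> \<bullet> y)) * W 0) \<in> borel_measurable lborel"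
      by (rule borel_measurable_times[OF borel_measurable_integrable[OF integrable_times_cis[OF w(2)]] borel_measurable_const])
  qed
  have R: "(\<lambda>n. \<integral>z. w (- y + \<epsilon> n *\<^sub>R z) * fcheck W z \<partial>lborel) \<longlonglongrightarrow> (\<integral>z. w (- y) * fcheck W z \<partial>lborel)"
  proof (rule integral_dominated_convergence[where w = "\<lambda>\<xi>. A * cmod (fcheck W \<xi>)"])
    show "integrable lborel (\<lambda>\<xi>. A * cmod (fcheck W \<xi>))" using W by auto
    have "(\<lambda>n. w (- y + \<epsilon> n *\<^sub>R z)) \<longlonglongrightarrow> w (- y)" for z
    proof -
      have "(\<lambda>n. - y + \<epsilon> n *\<^sub>R z) \<longlonglongrightarrow> - y"
        using tendsto_add[OF tendsto_const[of "- y"] lim0[of z]] by simp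
      then show ?thesis by (rule isCont_tendsto_compose[OF isC[OF w(1)]])
    qed
    then show "AE z in lborel. (\<lambda>n. w (- y + \<epsilon> n *\<^sub>R z) * fcheck W z) \<longlonglongrightarrow> w (- y) * fcheck W z"
      by (intro AE_I2 tendsto_mult_right)
    show "AE z in lborel. cmod (w (- y + \<epsilon> n *\<^sub>R z) * fcheck W z) \<le> A * cmod (fcheck W z)" for n
      using A by (intro AE_I2) (simp add: norm_mult mult_right_mono)
    show "(\<lambda>z. w (- y + \<epsilon> n *\<^sub>R z) * fcheck W z) \<in> borel_measurable lborel" for n
      using W mw by (intro borel_measurable_times) auto
    show "(\<lambda>z. w (- y) * fcheck W z) \<in> borel_measurable lborel"
      using W by (intro borel_measurable_times) auto
  qed
  have "(\<integral>\<xi>. fcheck w \<xi> * cis (2 * pi * (\<xi> \<bullet> y)) * W 0 \<partial>lborel) = (\<integral>z. w (- y) * fcheck W z \<partial>lborel)"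
    using L R unfolding double_fcheck_regularized[OF w(1) W(1) \<epsilon>(1)] by (rule LIMSEQ_unique)
  moreover have "(\<integral>\<xi>. fcheck w \<xi> * cis (2 * pi * (\<xi> \<bullet> y)) * W 0 \<partial>lborel) = fcheck (fcheck w) y * W 0"
    unfolding fcheck_def[of "fcheck w"] by (rule integral_mult_left_zero)
  moreover have "(\<integral>z. w (- y) * fcheck W z \<partial>lborel) = w (- y) * (\<integral>z. fcheck W z \<partial>lborel)"
    by (rule integral_mult_right_zero)
  ultimately show ?thesis by simp
qed

lemma cc_bump:
  fixes b :: "real^'d::finite \<Rightarrow> real"
  assumes "smooth (\<lambda>x. complex_of_real (b x))" "\<And>x. norm x > \<delta> \<Longrightarrow> b x = 0"
  shows "cc (\<lambda>x. complex_of_real (b x))"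
proof (rule ccI[of _ \<delta>])
  have "continuous_on UNIV (pderivs [] (\<lambda>x. complex_of_real (b x)))"
    using assms(1) unfolding smooth_def by blast
  then show "continuous_on UNIV (\<lambda>x. complex_of_real (b x))" by simp
qed (simp add: assms(2))

text \<open>The summability kernel \<open>W = f * f~\<close> has the nonnegative transform \<open>|f^|\<^sup>2\<close>, so the constant
  \<open>(\<integral> W^) / W 0\<close> is visibly positive; its value 1 is never needed, which avoids computing the
  transform of a Gaussian.\<close>

lemma Fourier_inversion_up_to_constant:
  "\<exists>c>0. \<forall>w::real^'d::finite \<Rightarrow> complex. cc w \<longrightarrow> integrable lborel (fcheck w) \<longrightarrow>
     (\<forall>y. fcheck (fcheck w) y = complex_of_real c * w (- y))"
proof -
  obtain b :: "real^'d \<Rightarrow> real" where b: "smooth (\<lambda>x. complex_of_real (b x))" "\<And>x. b x \<ge> 0"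
    "b 0 > 0" "\<And>x. norm x > 1 \<Longrightarrow> b x = 0"
    using smooth_bump_exists[of 1, where 'd = 'd] by (metis zero_less_one)
  define f where "f x = complex_of_real (b x)" for x
  have f: "smooth f" "cc f" unfolding f_def[abs_def] using b(1) cc_bump[OF b(1,4)] by auto
  define W where "W = fconv f (tilde f)"
  have W: "cc W" unfolding W_def by (rule cc_fconv[OF f(2) cc_tilde[OF f(2)]])
  have Wh: "fcheck W = (\<lambda>y. complex_of_real ((cmod (fcheck f y))\<^sup>2))"
    unfolding W_def fcheck_fconv[OF f(2) cc_tilde[OF f(2)]] fcheck_tilde[OF cc_continuous[OF f(2)]]
    by (simp only: complex_norm_square)
  \<comment> \<open>A bounded integrable transform is square integrable.\<close>
  obtain M where M: "\<And>y. cmod (fcheck f y) \<le> M" using fcheck_norm_le by blast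
  have cf: "continuous_on UNIV (fcheck f)" by (rule fcheck_continuous[OF integrable_cc[OF f(2)]])
  have int2: "integrable lborel (\<lambda>y. (cmod (fcheck f y))\<^sup>2)"
  proof (rule Bochner_Integration.integrable_bound)
    have "integrable lborel (fcheck f)"
      by (rule rapid_decay_integrable[OF cf fcheck_rapid_decay[OF f]])
    then show "integrable lborel (\<lambda>y. M * cmod (fcheck f y))" by auto
    have "(\<lambda>y. (cmod (fcheck f y))\<^sup>2) \<in> borel_measurable borel"
      by (intro borel_measurable_continuous_onI continuous_intros cf)
    then show "(\<lambda>y. (cmod (fcheck f y))\<^sup>2) \<in> borel_measurable lborel" by simp
    have "M \<ge> 0" using order_trans[OF norm_ge_zero M] .
    then show "AE y in lborel. norm ((cmod (fcheck f y))\<^sup>2) \<le> norm (M * cmod (fcheck f y))"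
      by (intro AE_I2) (simp add: power2_eq_square abs_mult mult_right_mono M)
  qed
  have cb: "continuous_on UNIV b"
    using continuous_on_Re[OF cc_continuous[OF f(2)]] by (simp add: f_def)
  have ib: "integrable lborel b"
    using integrable_Re[OF integrable_cc[OF f(2)]] by (simp add: f_def)
  have posb: "integral\<^sup>L lborel b > 0"
    by (rule continuous_nonneg_integral_pos[OF cb b(2) ib b(3)])
  \<comment> \<open>The transform at 0 is the positive integral of \<open>b\<close>, so the
    continuous function |\<open>fcheck f\<close>|^2 is positive at a point and has positive integral
    \<open>c1\<close>.\<close>
  have "fcheck f 0 = complex_of_real (integral\<^sup>L lborel b)"
    by (simp add: fcheck_def f_def)
  then have f0: "(cmod (fcheck f 0))\<^sup>2 > 0" using posb by simp
  define c1 where "c1 = (\<integral>y. (cmod (fcheck f y))\<^sup>2 \<partial>lborel)"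
  have c1: "c1 > 0" unfolding c1_def
    by (rule continuous_nonneg_integral_pos[OF _ _ int2 f0]) (auto intro!: continuous_intros cf)
  \<comment> \<open>This is \<open>W 0\<close>, the value of \<open>fconv f (tilde f)\<close> at the
    origin.\<close>
  define c2 where "c2 = (\<integral>y. (b y)\<^sup>2 \<partial>lborel)"
  have "integrable lborel (\<lambda>y. complex_of_real (b y) * complex_of_real (b y))"
    using integrable_cc[OF cc_times[OF cc_continuous[OF f(2)] f(2)]] by (simp add: f_def)
  from integrable_Re[OF this] have "integrable lborel (\<lambda>y. (b y)\<^sup>2)" by (simp add: power2_eq_square)
  then have c2: "c2 > 0" unfolding c2_def
    by (rule continuous_nonneg_integral_pos[of _ 0, rotated 2])
       (use b(3) in \<open>auto intro!: continuous_intros cb\<close>)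
  have W0: "W 0 = complex_of_real c2"
    unfolding W_def fconv_def tilde_def c2_def f_def
    by (simp add: power2_eq_square flip: of_real_mult)
  have intWh: "integrable lborel (fcheck W)" unfolding Wh using int2 by (rule integrable_of_real)
  have Wint: "(\<integral>z. fcheck W z \<partial>lborel) = complex_of_real c1"
    unfolding Wh c1_def by (rule integral_complex_of_real)
  show ?thesis
  proof (intro exI[of _ "c1 / c2"] conjI allI impI)
    show "0 < c1 / c2" using c1 c2 by simp
    fix w :: "real^'d \<Rightarrow> complex" and y
    assume w: "cc w" "integrable lborel (fcheck w)"
    have "fcheck (fcheck w) y * complex_of_real c2 = w (- y) * complex_of_real c1"
      using double_fcheck_times[OF w W intWh, of y] by (simp only: W0 Wint)
    then show "fcheck (fcheck w) y = complex_of_real (c1 / c2) * w (- y)"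
      using c2 by (simp add: field_simps)
  qed
qed

subsection \<open>Regularized test functions\<close>

text \<open>Piecewise linear in the norm: 1 up to radius \<open>R\<close>, 0 beyond
  \<open>R + 1\<close>. Continuity is enough, because smoothness of the test functions comes from
  the bump they are convolved with.\<close>

definition cutoff :: "real \<Rightarrow> 'a::real_normed_vector \<Rightarrow> real" where
  "cutoff R x = max 0 (min 1 (R + 1 - norm x))"

lemma cutoff_props:
  "cutoff R x \<ge> 0" "cutoff R x \<le> 1" "norm x \<le> R \<Longrightarrow> cutoff R x = 1"
  "norm x > R + 1 \<Longrightarrow> cutoff R x = 0" "continuous_on UNIV (cutoff R)"
  unfolding cutoff_def[abs_def] by (auto intro!: continuous_intros)

lemma cutoff_tendsto_1: "(\<lambda>n. cutoff (real n) x) \<longlonglongrightarrow> 1"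
proof (rule tendsto_eventually)
  show "\<forall>\<^sub>F n in sequentially. cutoff (real n) x = 1"
    using eventually_ge_at_top[of "nat \<lceil>norm x\<rceil>"]
    by eventually_elim (rule cutoff_props, linarith)
qed

lemma cc_times_cutoff:
  assumes "continuous_on UNIV f"
  shows "cc (\<lambda>x. f x * complex_of_real (cutoff R x))"
  by (rule ccI[of _ "R + 1"]) (auto intro!: continuous_intros assms cutoff_props(5) simp: cutoff_props(4))

text \<open>A supremum of reals is informative only on a bounded set, so both bounds on
  \<open>seminorm\<close> are drawn from a single pointwise estimate.\<close>

lemma seminorm_bounds:
  assumes "\<And>x. (1 + norm x) ^ N * cmod (pderivs is g x) \<le> B"
  shows "0 \<le> seminorm N is g" "seminorm N is g \<le> B"
proof -
  have bdd: "bdd_above (range (\<lambda>x. (1 + norm x) ^ N * cmod (pderivs is g x)))"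
    by (rule bdd_aboveI[of _ B]) (use assms in auto)
  show "seminorm N is g \<le> B" unfolding seminorm_def by (rule cSUP_least) (use assms in auto)
  show "0 \<le> seminorm N is g" unfolding seminorm_def
    by (rule cSUP_upper2[OF bdd UNIV_I[of 0]]) simp
qed

lemma fconv_diff_left:
  assumes "continuous_on UNIV u" "continuous_on UNIV v" "cc f"
  shows "fconv (\<lambda>x. u x - v x) f = (\<lambda>x. fconv u f x - fconv v f x)"
  unfolding fconv_def left_diff_distrib
  by (rule ext) (intro Bochner_Integration.integral_diff fconv_integrable assms)

text \<open>\<open>T\<close> is controlled by finitely many seminorms. The difference is spelled
  \<open>1 * G n x + (-1) * g x\<close> to match the linearity clause of
  \<open>tempered_dist\<close>.\<close>

lemma tempered_dist_tendsto:
  assumes T: "tempered_dist T" and g: "schwartz g" "\<And>n. schwartz (G n)"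
    and d: "\<And>n. schwartz (\<lambda>x. 1 * G n x + (-1) * g x)"
    and lim: "\<And>N is. (\<lambda>n. seminorm N is (\<lambda>x. 1 * G n x + (-1) * g x)) \<longlonglongrightarrow> 0"
  shows "(\<lambda>n. T (G n)) \<longlonglongrightarrow> T g"
proof -
  obtain C N where C: "\<And>f. schwartz f \<Longrightarrow>
        cmod (T f) \<le> C * (\<Sum>k\<le>N. \<Sum>is\<in>{is. length is \<le> N}. seminorm k is f)"
    using T unfolding tempered_dist_def by blast
  have "(\<lambda>n. C * (\<Sum>k\<le>N. \<Sum>is\<in>{is. length is \<le> N}. seminorm k is (\<lambda>x. 1 * G n x + (-1) * g x)))
      \<longlonglongrightarrow> C * (\<Sum>k\<le>N. \<Sum>is\<in>{is::'a list. length is \<le> N}. 0)"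
    by (intro tendsto_mult tendsto_const tendsto_sum lim)
  then have "(\<lambda>n. C * (\<Sum>k\<le>N. \<Sum>is\<in>{is. length is \<le> N}. seminorm k is (\<lambda>x. 1 * G n x + (-1) * g x))) \<longlonglongrightarrow> 0"
    by simp
  then have "(\<lambda>n. T (\<lambda>x. 1 * G n x + (-1) * g x)) \<longlonglongrightarrow> 0"
    by (rule Lim_null_comparison[rotated]) (intro always_eventually allI C d)
  moreover have "T (\<lambda>x. 1 * G n x + (-1) * g x) = 1 * T (G n) + (-1) * T g" for n
    using T g unfolding tempered_dist_def by blast
  ultimately have "(\<lambda>n. T (G n) - T g) \<longlonglongrightarrow> 0" by simp
  then show ?thesis by (rule LIM_zero_cancel)
qed

text \<open>The decay of \<open>k\<close> is demanded as weighted integrability because this is what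
  dominated convergence of the cutoffs consumes. Convolution with the inner \<open>f\<close>
  converts it to weighted sup decay, and the outer \<open>f\<close> then gives a Schwartz
  function.\<close>

lemma tempered_ext_regularized:
  fixes k f :: "real^'d::finite \<Rightarrow> complex"
  assumes ft: "ft_pair mu muh" and T: "tempered_ext mu T"
    and f: "smooth f" "cc f" "tilde f = f"
    and k: "continuous_on UNIV k" "\<And>N. integrable lborel (\<lambda>y. (1 + norm y) ^ N * cmod (k y))"
  shows "schwartz (fconv (fconv k f) f)"
    and "T (fconv (fconv k f) f) = mapply muh (\<lambda>y. fcheck k y * (fcheck f y * cnj (fcheck f y)))"
proof -
  have decay: "\<exists>S. \<forall>y. (1 + norm y) ^ N * cmod (fconv q f y) \<le> S"
    if "\<And>N. integrable lborel (\<lambda>y. (1 + norm y) ^ N * cmod (q y))" for q N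
    using cc_weighted_bounded[OF f(2), of N] norm_fconv_weighted_le[OF _ that] by blast
  have sch: "schwartz (fconv (fconv q f) f)"
    if "continuous_on UNIV q" "\<And>N. integrable lborel (\<lambda>y. (1 + norm y) ^ N * cmod (q y))" for q
    by (intro schwartz_fconv fconv_continuous f decay that)
  show sg: "schwartz (fconv (fconv k f) f)" by (rule sch[OF k])
  have kint: "integrable lborel k"
    by (rule integrable_norm_cancel)
       (use k(2)[of 0] borel_measurable_continuous_UNIV[OF k(1)] in simp_all)
  define K where "K n x = k x * complex_of_real (cutoff (real n) x)" for n x
  have K: "cc (K n)" for n unfolding K_def[abs_def] by (rule cc_times_cutoff[OF k(1)])
  have cK: "continuous_on UNIV (K n)" for n by (rule cc_continuous[OF K])
  have Kle: "cmod (K n x) \<le> cmod (k x)" for n x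
    using mult_left_mono[OF cutoff_props(2), of "cmod (k x)" "real n" x]
    by (simp add: K_def norm_mult cutoff_props)
  have Klim: "(\<lambda>n. K n x) \<longlonglongrightarrow> k x" for x
    unfolding K_def using tendsto_mult[OF tendsto_const tendsto_of_real[OF cutoff_tendsto_1]] by fastforce
  \<comment> \<open>The cutoff error. The difference of the test functions is the double convolution
    of \<open>q n\<close>, so its weighted integrals, which tend to 0 under the majorant |k|,
    control every seminorm.\<close>
  define q where "q n x = K n x - k x" for n x
  have cq: "continuous_on UNIV (q n)" for n
    unfolding q_def[abs_def] by (intro continuous_on_diff cK k)
  have qle: "cmod (q n x) \<le> cmod (k x)" for n x
  proof -
    have "q n x = - (k x * complex_of_real (1 - cutoff (real n) x))"
      by (simp add: q_def K_def algebra_simps)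
    then have "cmod (q n x) = cmod (k x) * (1 - cutoff (real n) x)"
      using cutoff_props(2)[of "real n" x] by (simp only: norm_minus_cancel norm_mult norm_of_real)
    also have "\<dots> \<le> cmod (k x) * 1"
      by (intro mult_left_mono) (auto simp: cutoff_props)
    finally show ?thesis by simp
  qed
  have qmeas: "(\<lambda>y. (1 + norm y) ^ N * cmod (q n y)) \<in> borel_measurable lborel" for N n
  proof -
    have "(\<lambda>y. (1 + norm y) ^ N * cmod (q n y)) \<in> borel_measurable borel"
      by (intro borel_measurable_continuous_onI continuous_intros cq)
    then show ?thesis by simp
  qed
  have wqle: "norm ((1 + norm y) ^ N * cmod (q n y)) \<le> (1 + norm y) ^ N * cmod (k y)" for N n y
    using qle[of n y] by (simp add: abs_mult mult_left_mono)
  have qint: "integrable lborel (\<lambda>y. (1 + norm y) ^ N * cmod (q n y))" for N n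
    by (rule Bochner_Integration.integrable_bound[OF k(2)[of N] qmeas]) (intro AE_I2 order_trans[OF wqle], simp)
  have qlim: "(\<lambda>n. \<integral>y. (1 + norm y) ^ N * cmod (q n y) \<partial>lborel) \<longlonglongrightarrow> 0" for N
  proof -
    have "(\<lambda>n. \<integral>y. (1 + norm y) ^ N * cmod (q n y) \<partial>lborel) \<longlonglongrightarrow> (\<integral>y. (0::real) \<partial>(lborel :: (real^'d) measure))"
    proof (rule integral_dominated_convergence[OF _ qmeas k(2)[of N]])
      have "(\<lambda>n. q n y) \<longlonglongrightarrow> 0" for y unfolding q_def by (rule LIM_zero[OF Klim])
      then have "(\<lambda>n. (1 + norm y) ^ N * cmod (q n y)) \<longlonglongrightarrow> (1 + norm y) ^ N * 0" for y
        by (intro tendsto_mult_left tendsto_norm_zero)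
      then show "AE y in lborel. (\<lambda>n. (1 + norm y) ^ N * cmod (q n y)) \<longlonglongrightarrow> 0" by simp
      show "AE y in lborel. norm ((1 + norm y) ^ N * cmod (q n y)) \<le> (1 + norm y) ^ N * cmod (k y)" for n
        by (intro AE_I2 wqle)
    qed simp
    then show ?thesis by simp
  qed
  have diff: "(\<lambda>x. 1 * fconv (fconv (K n) f) f x + (-1) * fconv (fconv k f) f x) = fconv (fconv (q n) f) f" for n
    unfolding q_def[abs_def]
    by (simp add: fconv_diff_left fconv_continuous cK k f)
  have Tlim: "(\<lambda>n. T (fconv (fconv (K n) f) f)) \<longlonglongrightarrow> T (fconv (fconv k f) f)"
  proof (rule tempered_dist_tendsto[OF _ sg])
    show "tempered_dist T" using T by (simp add: tempered_ext_def)
    show "schwartz (fconv (fconv (K n) f) f)" for n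
      by (rule sch[OF cK cc_weighted_integrable[OF K]])
    show "schwartz (\<lambda>x. 1 * fconv (fconv (K n) f) f x + (-1) * fconv (fconv k f) f x)" for n
      unfolding diff by (rule sch[OF cq qint])
    show "(\<lambda>n. seminorm N is (\<lambda>x. 1 * fconv (fconv (K n) f) f x + (-1) * fconv (fconv k f) f x)) \<longlonglongrightarrow> 0" for N "is"
    proof -
      obtain S where S: "\<And>y. (1 + norm y) ^ N * cmod (f y) \<le> S"
        using cc_weighted_bounded[OF f(2)] by blast
      let ?J = "\<integral>y. (1 + norm y) ^ N * cmod (pderivs is f y) \<partial>lborel"
      let ?I = "\<lambda>n. \<integral>y. (1 + norm y) ^ N * cmod (q n y) \<partial>lborel"
      have b: "(1 + norm x) ^ N * cmod (pderivs is (fconv (fconv (q n) f) f) x) \<le> (S * ?I n) * ?J" for n x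
        by (rule seminorm_fconv_le[OF fconv_continuous[OF cq f(2)] f(1,2) norm_fconv_weighted_le[OF S qint]])
      have "(\<lambda>n. (S * ?I n) * ?J) \<longlonglongrightarrow> (S * 0) * ?J"
        by (intro tendsto_mult tendsto_const qlim)
      then have z: "(\<lambda>n. (S * ?I n) * ?J) \<longlonglongrightarrow> 0" by simp
      show ?thesis unfolding diff
        by (rule tendsto_sandwich[OF _ _ tendsto_const z])
           (intro always_eventually allI seminorm_bounds[OF b])+
    qed
  qed
  \<comment> \<open>With \<open>K n\<close> of compact support the test function is smooth and in
    C_c. There \<open>T\<close> agrees with \<open>mu\<close>, and polarization applies to
    \<open>fconv (K n) f\<close> and \<open>f\<close> because \<open>tilde f = f\<close>.\<close>
  have Teq: "T (fconv (fconv (K n) f) f) = mapply muh (\<lambda>y. fcheck (K n) y * (fcheck f y * cnj (fcheck f y)))" for n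
  proof -
    have "T (fconv (fconv (K n) f) f) = mapply mu (fconv (fconv (K n) f) f)"
      using T smooth_fconv[OF fconv_continuous[OF cK f(2)] f(1,2)] cc_fconv[OF cc_fconv[OF K f(2)] f(2)]
      unfolding tempered_ext_def by blast
    also have "\<dots> = mapply muh (\<lambda>y. fcheck (fconv (K n) f) y * cnj (fcheck f y))"
      using ft_pair_polarized(1)[OF ft cc_fconv[OF K f(2)] f(2), of n] by (simp only: f(3))
    finally show ?thesis unfolding fcheck_fconv[OF K f(2)] by (simp only: mult.assoc)
  qed
  let ?P = "\<lambda>y. fcheck f y * cnj (fcheck f y)"
  have P: "integrable (fst muh) ?P" by (rule ft_pair_polarized(2)[OF ft f(2) f(2)])
  have rad: "radon muh" using ft by (simp add: ft_pair_def)
  \<comment> \<open>Bounds |\<open>fcheck (K n)\<close>| for all \<open>n\<close> at once, so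
    \<open>A\<close> times the integrable |\<open>fcheck f\<close>|^2 is a common majorant.\<close>
  define A where "A = (\<integral>x. cmod (k x) \<partial>lborel)"
  have "(\<lambda>n. mapply muh (\<lambda>y. fcheck (K n) y * ?P y)) \<longlonglongrightarrow> mapply muh (\<lambda>y. fcheck k y * ?P y)"
    unfolding mapply_def
  proof (rule integral_dominated_convergence[where w = "\<lambda>y. A * cmod (?P y)"])
    have sets: "sets (fst muh) = sets borel" using rad by (simp add: radon_def)
    have m: "(\<lambda>y. fcheck p y * ?P y * snd muh y) \<in> borel_measurable (fst muh)" if "integrable lborel p" for p
    proof (rule borel_measurable_times[OF borel_measurable_times])
      show "fcheck p \<in> borel_measurable (fst muh)"
        using borel_measurable_continuous_UNIV[OF fcheck_continuous[OF that]] sets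
        by (simp cong: measurable_cong_sets)
      show "snd muh \<in> borel_measurable (fst muh)"
        using rad sets by (auto simp: radon_def cong: measurable_cong_sets)
      show "?P \<in> borel_measurable (fst muh)" by (rule borel_measurable_integrable[OF P])
    qed
    show "(\<lambda>y. fcheck (K n) y * ?P y * snd muh y) \<in> borel_measurable (fst muh)" for n
      by (rule m[OF integrable_cc[OF K]])
    show "(\<lambda>y. fcheck k y * ?P y * snd muh y) \<in> borel_measurable (fst muh)" by (rule m[OF kint])
    show "integrable (fst muh) (\<lambda>y. A * cmod (?P y))"
      using P by (intro integrable_mult_right integrable_norm)
    have "cmod (fcheck (K n) y) \<le> A" for n y
    proof -
      have "cmod (fcheck (K n) y) \<le> (\<integral>x. cmod (K n x) \<partial>lborel)" by (rule fcheck_norm_le)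
      also have "\<dots> \<le> A" unfolding A_def
        by (rule integral_mono[OF integrable_norm[OF integrable_cc[OF K]] integrable_norm[OF kint] Kle])
      finally show ?thesis .
    qed
    then show "AE y in fst muh. cmod (fcheck (K n) y * ?P y * snd muh y) \<le> A * cmod (?P y)" for n
      using rad by (intro AE_I2) (simp add: norm_mult radon_def mult_right_mono)
    have "(\<lambda>n. fcheck (K n) y) \<longlonglongrightarrow> fcheck k y" for y
      unfolding fcheck_def
    proof (rule integral_dominated_convergence[where w = "\<lambda>x. cmod (k x)"])
      show "AE x in lborel. (\<lambda>n. K n x * cis (2 * pi * (x \<bullet> y))) \<longlonglongrightarrow> k x * cis (2 * pi * (x \<bullet> y))"
        by (intro AE_I2 tendsto_mult_right Klim)
      show "AE x in lborel. cmod (K n x * cis (2 * pi * (x \<bullet> y))) \<le> cmod (k x)" for n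
        by (intro AE_I2) (simp add: norm_mult Kle)
    qed (use integrable_times_cis[OF integrable_cc[OF K]] integrable_times_cis[OF kint] kint in auto)
    then show "AE y in fst muh. (\<lambda>n. fcheck (K n) y * ?P y * snd muh y) \<longlonglongrightarrow> fcheck k y * ?P y * snd muh y"
      by (intro AE_I2 tendsto_mult_right)
  qed
  with Tlim show "T (fconv (fconv k f) f) = mapply muh (\<lambda>y. fcheck k y * ?P y)"
    unfolding Teq by (rule LIMSEQ_unique)
qed

section \<open>Equicontinuity from vague boundedness\<close>

lemma mapply_norm_le:
  assumes "radon m" "integrable (fst m) g" "\<And>x. cmod (f x) \<le> g x"
  shows "cmod (mapply m f) \<le> integral\<^sup>L (fst m) g"
proof -
  have "cmod (mapply m f) \<le> (\<integral>x. cmod (f x * snd m x) \<partial>fst m)"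
    unfolding mapply_def by (rule integral_norm_bound)
  also have "\<dots> \<le> integral\<^sup>L (fst m) g"
    by (rule integral_mono') (use assms in \<open>auto simp: norm_mult radon_def intro: order_trans[OF norm_ge_zero]\<close>)
  finally show ?thesis .
qed

lemma vaguely_bounded_uniform:
  fixes m :: "nat \<Rightarrow> 'd::finite rmeasure"
  assumes rad: "\<And>n. radon (m n)" and vb: "vaguely_bounded (range m)"
  shows "\<exists>M\<ge>0. \<forall>n \<phi> B. cc \<phi> \<longrightarrow> (\<forall>x. norm x > r \<longrightarrow> \<phi> x = 0) \<longrightarrow> (\<forall>x. cmod (\<phi> x) \<le> B)
            \<longrightarrow> cmod (mapply (m n) \<phi>) \<le> M * B"
proof -
  \<comment> \<open>The cutoff turns each measure into a bounded functional on the Banach space of all bounded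
     continuous functions.\<close>
  define T :: "nat \<Rightarrow> ((real^'d) \<Rightarrow>\<^sub>C complex) \<Rightarrow> complex"
    where "T n u = mapply (m n) (\<lambda>x. apply_bcontfun u x * complex_of_real (cutoff r x))" for n u
  have ccu: "cc (\<lambda>x. apply_bcontfun u x * complex_of_real (cutoff r x))" for u :: "(real^'d) \<Rightarrow>\<^sub>C complex"
    by (rule cc_times_cutoff) simp
  have lin: "bounded_linear (T n)" for n
  proof (rule bounded_linear_intro)
    let ?c = "\<lambda>x::real^'d. complex_of_real (cutoff r x)"
    have "cc ?c" using cc_times_cutoff[of "\<lambda>_. 1" r] by simp
    from integrable_norm[OF radon_integrable_cc[OF rad[of n] this]]
    have int: "integrable (fst (m n)) (\<lambda>x. norm (?c x * snd (m n) x))" .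
    have ic: "integrable (fst (m n)) (\<lambda>x. cutoff r x)"
    proof -
      have "cmod (snd (m n) x) = 1" for x using rad[of n] by (simp add: radon_def)
      then show ?thesis using int by (simp add: norm_mult cutoff_props)
    qed
    show "T n (u + v) = T n u + T n v" for u v
      unfolding T_def plus_bcontfun.rep_eq distrib_right
      by (intro mapply_add radon_integrable_cc rad ccu)
    show "T n (a *\<^sub>R u) = a *\<^sub>R T n u" for a u
      unfolding T_def scaleR_bcontfun.rep_eq scaleR_conv_of_real mult.assoc by (rule mapply_cmult)
    show "norm (T n u) \<le> norm u * integral\<^sup>L (fst (m n)) (cutoff r)" for u
    proof -
      have "cmod (T n u) \<le> (\<integral>x. norm u * cutoff r x \<partial>fst (m n))"
        unfolding T_def
        by (rule mapply_norm_le[OF rad integrable_mult_right[OF ic]])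
           (simp add: norm_mult cutoff_props norm_bounded mult_right_mono)
      then show ?thesis by simp
    qed
  qed
  have "bounded (range (\<lambda>n. T n u))" for u
  proof -
    have "bounded ((\<lambda>\<nu>. mapply \<nu> (\<lambda>x. apply_bcontfun u x * complex_of_real (cutoff r x))) ` range m)"
      using vb ccu unfolding vaguely_bounded_def by blast
    then show ?thesis unfolding T_def by (simp add: image_image)
  qed
  with uniform_boundedness_principle[of T] lin
  obtain M where M: "\<And>n u. norm (T n u) \<le> M * norm u" by blast
  have "cmod (mapply (m n) \<phi>) \<le> \<bar>M\<bar> * B"
    if \<phi>: "cc \<phi>" "\<And>x. norm x > r \<Longrightarrow> \<phi> x = 0" "\<And>x. cmod (\<phi> x) \<le> B" for n \<phi> B
  proof -
    have "\<phi> \<in> bcontfun" by (rule bcontfun_normI[OF cc_continuous[OF \<phi>(1)] \<phi>(3)])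
    then have app: "apply_bcontfun (Bcontfun \<phi>) = \<phi>" by (rule Bcontfun_inverse)
    \<comment> \<open>The cutoff is 1 on the ball of radius \<open>r\<close>, which contains the
      support of \<open>\<phi>\<close>, so \<open>T n\<close> evaluates the measure at
      \<open>\<phi>\<close> itself.\<close>
    have "\<phi> x * complex_of_real (cutoff r x) = \<phi> x" for x
      using \<phi>(2)[of x] cutoff_props(3)[of x r] by (cases "norm x > r") auto
    then have e: "(\<lambda>x. \<phi> x * complex_of_real (cutoff r x)) = \<phi>" by blast
    have "cmod (mapply (m n) \<phi>) = norm (T n (Bcontfun \<phi>))" unfolding T_def app e ..
    also have "\<dots> \<le> M * norm (Bcontfun \<phi>)" by (rule M)
    also have "\<dots> \<le> \<bar>M\<bar> * norm (Bcontfun \<phi>)" by (rule mult_right_mono) auto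
    also have "\<dots> \<le> \<bar>M\<bar> * B"
      by (intro mult_left_mono norm_bound) (auto simp: app \<phi>(3))
    finally show ?thesis .
  qed
  then show ?thesis by (intro exI[of _ "\<bar>M\<bar>"]) auto
qed

subsection \<open>Approximation and the convergence theorem\<close>

lemma cc_uniform:
  fixes \<psi> :: "real^'d::finite \<Rightarrow> complex"
  assumes \<psi>: "cc \<psi>" and "\<eta> > 0"
  shows "\<exists>\<delta>>0. \<forall>x y. dist x y < \<delta> \<longrightarrow> cmod (\<psi> x - \<psi> y) < \<eta>"
proof -
  obtain r where r: "r > 0" "\<And>x. norm x > r \<Longrightarrow> \<psi> x = 0" using cc_support[OF \<psi>] by blast
  have "uniformly_continuous_on (cball 0 (r + 1)) \<psi>"
    by (intro compact_uniformly_continuous continuous_on_subset[OF cc_continuous[OF \<psi>]]) auto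
  then obtain \<delta> where \<delta>: "\<delta> > 0"
    "\<And>x y. x \<in> cball 0 (r + 1) \<Longrightarrow> y \<in> cball 0 (r + 1) \<Longrightarrow> dist y x < \<delta> \<Longrightarrow> dist (\<psi> y) (\<psi> x) < \<eta>"
    unfolding uniformly_continuous_on_def using \<open>\<eta> > 0\<close> by meson
  \<comment> \<open>Two points closer than 1 either both lie in the ball of radius
    \<open>r + 1\<close>, or both lie outside the ball of radius \<open>r\<close>, where
    \<open>\<psi>\<close> vanishes.\<close>
  have "cmod (\<psi> x - \<psi> y) < \<eta>" if d: "dist x y < min \<delta> 1" for x y
  proof (cases "norm x \<le> r + 1 \<and> norm y \<le> r + 1")
    case True
    then show ?thesis using \<delta>(2)[of y x] d by (simp add: dist_norm)
  next
    case False
    have "norm x \<le> norm y + dist x y" "norm y \<le> norm x + dist x y"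
      using norm_triangle_sub[of x y] norm_triangle_sub[of y x] by (simp_all add: dist_norm norm_minus_commute)
    then have "norm x > r" "norm y > r" using False d by linarith+
    then show ?thesis using r \<open>\<eta> > 0\<close> by simp
  qed
  then show ?thesis using \<delta>(1) by (intro exI[of _ "min \<delta> 1"]) auto
qed

text \<open>Take k = \<open>fcheck w\<close> for a rescaled, reflected mollification
  \<open>w\<close> of \<open>\<psi>\<close>. By inversion \<open>fcheck k\<close> is then
  \<open>\<psi>\<close> mollified by a normalized bump, which is uniformly close to
  \<open>\<psi>\<close> and supported slightly further out.\<close>

lemma Fourier_approximation:
  fixes \<psi> :: "real^'d::finite \<Rightarrow> complex"
  assumes \<psi>: "cc \<psi>" "\<And>x. norm x > r \<Longrightarrow> \<psi> x = 0" and \<eta>: "\<eta> > 0"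
  shows "\<exists>k. continuous_on UNIV k \<and> (\<forall>N. integrable lborel (\<lambda>y. (1 + norm y) ^ N * cmod (k y)))
     \<and> (\<forall>y. cmod (fcheck k y - \<psi> y) \<le> \<eta>) \<and> (\<forall>y. norm y > r + 1 \<longrightarrow> fcheck k y = 0)"
proof -
  obtain \<delta> where \<delta>: "\<delta> > 0" "\<And>x y. dist x y < \<delta> \<Longrightarrow> cmod (\<psi> x - \<psi> y) < \<eta>"
    using cc_uniform[OF \<psi>(1) \<eta>] by blast
  \<comment> \<open>The radius of the bump: at most 1 to keep the support within
    \<open>r + 1\<close>, and below \<open>\<delta>\<close> to keep the error within
    \<open>\<eta>\<close>.\<close>
  define \<rho> where "\<rho> = min 1 (\<delta> / 2)"
  have \<rho>: "\<rho> > 0" "\<rho> \<le> 1" "\<rho> < \<delta>" using \<delta>(1) by (auto simp: \<rho>_def)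
  obtain b :: "real^'d \<Rightarrow> real" where b: "smooth (\<lambda>x. complex_of_real (b x))" "\<And>x. b x \<ge> 0"
    "b 0 > 0" "\<And>x. norm x > \<rho> \<Longrightarrow> b x = 0"
    using smooth_bump_exists[OF \<rho>(1), where 'd = 'd] by metis
  define f where "f x = complex_of_real (b x)" for x
  have f: "smooth f" "cc f" unfolding f_def[abs_def] using b(1) cc_bump[OF b(1,4)] by auto
  have cb: "continuous_on UNIV b"
    using continuous_on_Re[OF cc_continuous[OF f(2)]] by (simp add: f_def)
  have ib: "integrable lborel b"
    using integrable_Re[OF integrable_cc[OF f(2)]] by (simp add: f_def)
  define c2 where "c2 = integral\<^sup>L lborel b"
  have c2: "c2 > 0" unfolding c2_def by (rule continuous_nonneg_integral_pos[OF cb b(2) ib b(3)])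
  obtain c where c: "c > 0" "\<And>w::real^'d \<Rightarrow> complex. cc w \<Longrightarrow> integrable lborel (fcheck w) \<Longrightarrow>
     (\<forall>y. fcheck (fcheck w) y = complex_of_real c * w (- y))"
    using Fourier_inversion_up_to_constant[where 'd = 'd] by blast
  \<comment> \<open>The reflection cancels the one in the inversion formula; the factor cancels its
    constant \<open>c\<close> and the mass \<open>c2\<close> of the bump.\<close>
  define v where "v x = complex_of_real (1 / (c * c2)) * \<psi> (0 - x)" for x
  have v: "cc v" unfolding v_def[abs_def] by (intro cc_cmult cc_reflect_shift \<psi>(1))
  define w where "w = fconv v f"
  have w: "smooth w" "cc w" unfolding w_def
    using smooth_fconv[OF cc_continuous[OF v] f] cc_fconv[OF v f(2)] by auto
  have ck: "continuous_on UNIV (fcheck w)" by (rule fcheck_continuous[OF integrable_cc[OF w(2)]])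
  have kk: "fcheck (fcheck w) y = complex_of_real c * w (- y)" for y
    using c(2)[OF w(2) rapid_decay_integrable[OF ck fcheck_rapid_decay[OF w]]] by blast
  have approx: "cmod (fcheck (fcheck w) y - \<psi> y) \<le> \<eta>" for y
  proof -
    have ccs: "cc (\<lambda>z. f (- y - z))" by (rule cc_reflect_shift[OF f(2)])
    have ibs: "integrable lborel (\<lambda>z. b (- y - z))"
      using integrable_Re[OF integrable_cc[OF ccs]] by (simp add: f_def)
    have intb: "(\<integral>z. b (- y - z) \<partial>lborel) = c2"
      unfolding c2_def by (rule lborel_integral_reflect_shift[OF borel_measurable_continuous_UNIV[OF cb]])
    have "w (- y) = (\<integral>z. v z * f (- y - z) \<partial>lborel)" by (simp only: w_def fconv_def)
    then have "fcheck (fcheck w) y = complex_of_real c * (\<integral>z. v z * f (- y - z) \<partial>lborel)"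
      by (simp only: kk)
    also have "\<dots> = (\<integral>z. complex_of_real c * (v z * f (- y - z)) \<partial>lborel)" by simp
    also have "\<dots> = (\<integral>z. (1 / c2) * (\<psi> (- z) * f (- y - z)) \<partial>lborel)"
      using c(1) by (intro Bochner_Integration.integral_cong) (auto simp: v_def field_simps)
    finally have 1: "fcheck (fcheck w) y = (\<integral>z. (1 / c2) * (\<psi> (- z) * f (- y - z)) \<partial>lborel)" .
    have "(\<integral>z. f (- y - z) \<partial>lborel) = complex_of_real c2"
      unfolding f_def intb[symmetric] by (rule integral_complex_of_real)
    \<comment> \<open>Writing the constant \<open>\<psi> y\<close> as an average over the same bump
      makes the error a single integral of differences of \<open>\<psi>\<close> at points closer
      than \<open>\<delta>\<close>.\<close>
    then have 2: "\<psi> y = (\<integral>z. (1 / c2) * (\<psi> y * f (- y - z)) \<partial>lborel)"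
      using c2 by simp
    have i1: "integrable lborel (\<lambda>z. (1 / c2) * (\<psi> (- z) * f (- y - z)))"
      using integrable_cc[OF cc_times[OF cc_continuous[OF cc_reflect_shift[OF \<psi>(1), of 0]] ccs]]
      by (intro integrable_mult_right) simp
    have i2: "integrable lborel (\<lambda>z. (1 / c2) * (\<psi> y * f (- y - z)))"
      by (intro integrable_mult_right integrable_cc ccs)
    have "fcheck (fcheck w) y - \<psi> y =
        (\<integral>z. (1 / c2) * (\<psi> (- z) * f (- y - z)) - (1 / c2) * (\<psi> y * f (- y - z)) \<partial>lborel)"
      unfolding Bochner_Integration.integral_diff[OF i1 i2] 1[symmetric] 2[symmetric] ..
    then have "cmod (fcheck (fcheck w) y - \<psi> y) \<le>
        (\<integral>z. cmod ((1 / c2) * (\<psi> (- z) * f (- y - z)) - (1 / c2) * (\<psi> y * f (- y - z))) \<partial>lborel)"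
      by (simp only: integral_norm_bound)
    also have "\<dots> \<le> (\<integral>z. (\<eta> / c2) * b (- y - z) \<partial>lborel)"
    proof (rule integral_mono')
      show "integrable lborel (\<lambda>z. (\<eta> / c2) * b (- y - z))" by (rule integrable_mult_right[OF ibs])
      fix z
      show "0 \<le> (\<eta> / c2) * b (- y - z)" using \<eta> c2 b(2) by simp
      have "cmod (\<psi> (- z) - \<psi> y) * b (- y - z) \<le> \<eta> * b (- y - z)"
      proof (cases "norm (- y - z) > \<rho>")
        case True
        then show ?thesis using b(4) by simp
      next
        case False
        then have "dist (- z) y < \<delta>" using \<rho> by (simp add: dist_norm norm_minus_commute add.commute)
        then show ?thesis using \<delta>(2)[of "- z" y] b(2) by (intro mult_right_mono) auto
      qed
      then have le: "(cmod (\<psi> (- z) - \<psi> y) * b (- y - z)) / c2 \<le> (\<eta> * b (- y - z)) / c2"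
        using c2 by (intro divide_right_mono) auto
      have "(1 / c2) * (\<psi> (- z) * f (- y - z)) - (1 / c2) * (\<psi> y * f (- y - z)) =
          complex_of_real (1 / c2) * ((\<psi> (- z) - \<psi> y) * f (- y - z))"
        by (simp add: algebra_simps)
      then have "cmod ((1 / c2) * (\<psi> (- z) * f (- y - z)) - (1 / c2) * (\<psi> y * f (- y - z))) =
          (cmod (\<psi> (- z) - \<psi> y) * b (- y - z)) / c2"
        using c2 b(2) by (simp only: norm_mult norm_of_real f_def) simp
      then show "cmod ((1 / c2) * (\<psi> (- z) * f (- y - z)) - (1 / c2) * (\<psi> y * f (- y - z))) \<le> (\<eta> / c2) * b (- y - z)"
        using le by simp
    qed
    also have "\<dots> = \<eta>" using intb c2 by simp
    finally show ?thesis .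
  qed
  have "fcheck (fcheck w) y = 0" if "norm y > r + 1" for y
  proof -
    have "w (- y) = 0" unfolding w_def
      by (rule fconv_zero_outside[of r _ 1]) (use \<psi>(2) b(4) \<rho> that in \<open>auto simp: v_def f_def\<close>)
    then show ?thesis unfolding kk by simp
  qed
  then show ?thesis
    using ck rapid_decay_weighted_integrable[OF ck fcheck_rapid_decay[OF w]] approx by blast
qed

text \<open>On a small enough support the phase stays within pi / 2, so the real part of the
  transform is the integral of a nonnegative function that is positive at 0.\<close>

lemma symmetric_bump_nonvanishing_fcheck:
  "\<exists>f::real^'d::finite \<Rightarrow> complex. smooth f \<and> cc f \<and> tilde f = f \<and> (\<forall>y. norm y \<le> r \<longrightarrow> fcheck f y \<noteq> 0)"
proof -
  \<comment> \<open>Chosen so that |x \<bullet> y| \<le> 1/4 on the support for all |y| \<le> r; the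
    absolute value and the 1 cover every real \<open>r\<close>.\<close>
  define \<delta> where "\<delta> = 1 / (4 * (\<bar>r\<bar> + 1))"
  have \<delta>: "\<delta> > 0" by (simp add: \<delta>_def add_nonneg_pos)
  obtain b :: "real^'d \<Rightarrow> real" where b: "smooth (\<lambda>x. complex_of_real (b x))" "\<And>x. b x \<ge> 0"
    "\<And>x. b (- x) = b x" "b 0 > 0" "\<And>x. norm x > \<delta> \<Longrightarrow> b x = 0"
    using smooth_bump_exists[OF \<delta>, where 'd = 'd] by metis
  define f where "f x = complex_of_real (b x)" for x
  have f: "smooth f" "cc f" unfolding f_def[abs_def] using b(1) cc_bump[OF b(1,5)] by auto
  have "fcheck f y \<noteq> 0" if y: "norm y \<le> r" for y
  proof -
    let ?g = "\<lambda>x. b x * cos (2 * pi * (x \<bullet> y))"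
    have i: "integrable lborel (\<lambda>x. f x * cis (2 * pi * (x \<bullet> y)))"
      by (rule integrable_times_cis[OF integrable_cc[OF f(2)]])
    have Re: "Re (f x * cis (2 * pi * (x \<bullet> y))) = ?g x" for x by (simp add: f_def)
    have ig: "integrable lborel ?g" using integrable_Re[OF i] by (simp only: Re)
    have cb: "continuous_on UNIV b"
      using continuous_on_Re[OF cc_continuous[OF f(2)]] by (simp add: f_def)
    have "?g x \<ge> 0" for x
    proof (cases "norm x > \<delta>")
      case False
      have "\<bar>x \<bullet> y\<bar> \<le> norm x * norm y" by (rule Cauchy_Schwarz_ineq2)
      also have "\<dots> \<le> \<delta> * (\<bar>r\<bar> + 1)" using False y \<delta> by (intro mult_mono) auto
      also have "\<dots> = 1 / 4" by (simp add: \<delta>_def)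
      finally have "\<bar>x \<bullet> y\<bar> \<le> 1 / 4" .
      then have "pi * \<bar>x \<bullet> y\<bar> \<le> pi * (1 / 4)" by (intro mult_left_mono) auto
      then have "\<bar>2 * pi * (x \<bullet> y)\<bar> \<le> pi / 2" by (simp add: abs_mult)
      then have "- (pi / 2) \<le> 2 * pi * (x \<bullet> y)" "2 * pi * (x \<bullet> y) \<le> pi / 2"
        unfolding abs_le_iff by linarith+
      then have "cos (2 * pi * (x \<bullet> y)) \<ge> 0" by (rule cos_ge_zero)
      then show ?thesis using b(2) by simp
    qed (simp add: b(5))
    moreover have "continuous_on UNIV ?g" by (intro continuous_intros cb)
    ultimately have "integral\<^sup>L lborel ?g > 0"
      by (intro continuous_nonneg_integral_pos[of _ 0] ig) (use b(4) in auto)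
    moreover have "Re (fcheck f y) = integral\<^sup>L lborel ?g"
      unfolding fcheck_def integral_Re[OF i, symmetric] Re ..
    ultimately show ?thesis by auto
  qed
  moreover have "tilde f = f" by (simp add: tilde_def f_def b(3) fun_eq_iff)
  ultimately show ?thesis using f by blast
qed

theorem theorem4p4:
  fixes mus muhs :: "nat \<Rightarrow> 'd::finite rmeasure" and mu muh :: "'d rmeasure"
  assumes "\<forall>n. ft_pair (mus n) (muhs n)"
    and "ft_pair mu muh"
    and "tempered_conv mus mu"
    and "vaguely_bounded (range muhs)"
  shows "\<forall>f. cc f \<longrightarrow> (\<lambda>n. mapply (muhs n) f) \<longlonglongrightarrow> mapply muh f"
proof (intro allI impI)
  fix \<phi> :: "real^'d \<Rightarrow> complex" assume \<phi>: "cc \<phi>"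
  obtain Ts T where Ts: "\<And>n. tempered_ext (mus n) (Ts n)" and T: "tempered_ext mu T"
    and conv: "\<And>f. schwartz f \<Longrightarrow> (\<lambda>n. Ts n f) \<longlonglongrightarrow> T f"
    using assms(3) unfolding tempered_conv_def by blast
  have ft: "ft_pair (mus n) (muhs n)" for n using assms(1) by blast
  have rad: "radon (muhs n)" "radon muh" for n using assms(1,2) by (auto simp: ft_pair_def)
  obtain r where r: "r > 0" "\<And>x. norm x > r \<Longrightarrow> \<phi> x = 0" using cc_support[OF \<phi>] by blast
  obtain f :: "real^'d \<Rightarrow> complex" where f: "smooth f" "cc f" "tilde f = f"
    and f_nz: "\<And>y. norm y \<le> r \<Longrightarrow> fcheck f y \<noteq> 0"
    using symmetric_bump_nonvanishing_fcheck[of r, where 'd = 'd] by blast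
  define P where "P y = (cmod (fcheck f y))\<^sup>2" for y
  have P_eq: "fcheck f y * cnj (fcheck f y) = complex_of_real (P y)" for y
    by (simp add: P_def complex_norm_square del: of_real_power)
  have cP: "continuous_on UNIV P"
    unfolding P_def[abs_def] by (intro continuous_intros fcheck_continuous integrable_cc f)
  \<comment> \<open>The minimum of \<open>P\<close> on the ball supporting \<open>\<phi>\<close> is
    attained and positive; it serves as a floor for the divisor of \<open>\<phi>\<close>.\<close>
  obtain a where a: "norm a \<le> r" "\<And>y. norm y \<le> r \<Longrightarrow> P a \<le> P y"
    using continuous_attains_inf[OF compact_cball[of 0 r] _ continuous_on_subset[OF cP]] r(1)
    by auto
  have Pa: "P a > 0" using f_nz[OF a(1)] by (simp add: P_def)
  \<comment> \<open>The 1 added to the bound makes \<open>A\<close> positive, as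
    \<open>\<eta>\<close> will have \<open>A\<close> in its denominator.\<close>
  obtain A where A: "\<And>y. P y \<le> A" "A > 0"
  proof -
    let ?A = "\<integral>x. cmod (f x) \<partial>lborel"
    have "P y \<le> ?A\<^sup>2" for y
      unfolding P_def by (rule power_mono[OF fcheck_norm_le norm_ge_zero])
    then have "P y \<le> ?A\<^sup>2 + 1" for y by (rule order_trans) simp
    then show ?thesis using that[of "?A\<^sup>2 + 1"] by (simp add: add_nonneg_pos)
  qed
  \<comment> \<open>This is \<open>\<phi> / P\<close>; the maximum only matters off the support of \<open>\<phi>\<close>, where \<open>P\<close> may vanish.\<close>
  define \<psi> where "\<psi> y = complex_of_real (1 / max (P a) (P y)) * \<phi> y" for y
  have "max (P a) (P y) \<noteq> 0" for y using Pa by (simp add: max_def)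
  then have \<psi>: "cc \<psi>" unfolding \<psi>_def[abs_def]
    by (intro cc_times \<phi> continuous_intros cP) auto
  have \<psi>0: "\<psi> y = 0" if "norm y > r" for y using r(2)[OF that] by (simp add: \<psi>_def)
  have \<psi>P: "\<psi> y * complex_of_real (P y) = \<phi> y" for y
  proof (cases "norm y \<le> r")
    case True
    then have "max (P a) (P y) = P y" "P y > 0" using a(2)[OF True] Pa by auto
    then show ?thesis by (simp add: \<psi>_def)
  qed (use r(2)[of y] \<psi>0 in auto)
  \<comment> \<open>Radius \<open>r + 1\<close> instead of \<open>r\<close>, because the
    approximations \<open>fcheck k\<close> may reach out by one unit.\<close>
  obtain M where M: "M \<ge> 0" "\<And>n \<phi> B. cc \<phi> \<Longrightarrow> (\<And>x. norm x > r + 1 \<Longrightarrow> \<phi> x = 0) \<Longrightarrow> (\<And>x. cmod (\<phi> x) \<le> B)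
      \<Longrightarrow> cmod (mapply (muhs n) \<phi>) \<le> M * B"
    using vaguely_bounded_uniform[OF rad(1) assms(4), of "r + 1"] by blast
  \<comment> \<open>A constant sequence is vaguely bounded, so the same lemma supplies the bound for
    the limit measure.\<close>
  have "vaguely_bounded (range (\<lambda>n::nat. muh))" by (simp add: vaguely_bounded_def)
  from vaguely_bounded_uniform[OF rad(2) this, of "r + 1"]
  obtain M' where M': "M' \<ge> 0" "\<And>\<phi> B. cc \<phi> \<Longrightarrow> (\<And>x. norm x > r + 1 \<Longrightarrow> \<phi> x = 0) \<Longrightarrow> (\<And>x. cmod (\<phi> x) \<le> B)
      \<Longrightarrow> cmod (mapply muh \<phi>) \<le> M' * B"
    by blast
  show "(\<lambda>n. mapply (muhs n) \<phi>) \<longlonglongrightarrow> mapply muh \<phi>"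
  proof (rule LIMSEQ_I)
    fix e :: real assume e: "e > 0"
    \<comment> \<open>The error \<open>d\<close> has sup norm at most \<open>\<eta> * A\<close>, so
      its two integrals contribute at most (M + M') times this. The 1 keeps the denominator nonzero
      and the resulting bound strictly below e / 2.\<close>
    define \<eta> where "\<eta> = e / (2 * A * (M + M' + 1))"
    have D: "2 * A * (M + M' + 1) > 0" using A M M' by simp
    have \<eta>: "\<eta> > 0" using e D by (simp add: \<eta>_def)
    obtain k where k: "continuous_on UNIV k" "\<And>N. integrable lborel (\<lambda>y. (1 + norm y) ^ N * cmod (k y))"
      "\<And>y. cmod (fcheck k y - \<psi> y) \<le> \<eta>" "\<And>y. norm y > r + 1 \<Longrightarrow> fcheck k y = 0"
      using Fourier_approximation[OF \<psi> \<psi>0 \<eta>] by blast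
    define \<Phi> where "\<Phi> y = fcheck k y * (fcheck f y * cnj (fcheck f y))" for y
    have kint: "integrable lborel k"
      by (rule integrable_norm_cancel)
         (use k(2)[of 0] borel_measurable_continuous_UNIV[OF k(1)] in simp_all)
    have \<Phi>: "cc \<Phi>" unfolding \<Phi>_def[abs_def] P_eq
      by (rule ccI[of _ "r + 1"]) (auto intro!: continuous_intros fcheck_continuous kint cP simp: k(4))
    \<comment> \<open>Tempered convergence is used at the single Schwartz function
      \<open>fconv (fconv k f) f\<close>, where the values of \<open>Ts n\<close> and
      \<open>T\<close> are the integrals of \<open>\<Phi>\<close> against \<open>muhs n\<close> and
      \<open>muh\<close>.\<close>
    have lim: "(\<lambda>n. mapply (muhs n) \<Phi>) \<longlonglongrightarrow> mapply muh \<Phi>"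
      using conv[OF tempered_ext_regularized(1)[OF assms(2) T f k(1,2)]]
      unfolding tempered_ext_regularized(2)[OF assms(2) T f k(1,2)]
        tempered_ext_regularized(2)[OF ft Ts f k(1,2)] \<Phi>_def[abs_def] .
    define d where "d y = \<phi> y + (-1) * \<Phi> y" for y
    have d: "cc d" unfolding d_def[abs_def] by (intro cc_add cc_cmult \<phi> \<Phi>)
    have d0: "d y = 0" if "norm y > r + 1" for y
      using that r(2)[of y] k(4)[of y] by (simp add: d_def \<Phi>_def)
    have dle: "cmod (d y) \<le> \<eta> * A" for y
    proof -
      have "d y = (\<psi> y - fcheck k y) * complex_of_real (P y)"
        by (simp add: d_def \<Phi>_def P_eq \<psi>P[symmetric] algebra_simps)
      then have "cmod (d y) = cmod (fcheck k y - \<psi> y) * P y"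
        by (simp only: norm_mult norm_of_real) (simp add: norm_minus_commute P_def)
      also have "\<dots> \<le> \<eta> * A" using k(3) A \<eta> by (intro mult_mono) (auto simp: P_def)
      finally show ?thesis .
    qed
    have split: "mapply m d = mapply m \<phi> - mapply m \<Phi>" if "radon m" for m
    proof -
      have "mapply m d = mapply m \<phi> + mapply m (\<lambda>y. (-1) * \<Phi> y)"
        unfolding d_def[abs_def] by (intro mapply_add radon_integrable_cc that \<phi> cc_cmult \<Phi>)
      then show ?thesis unfolding mapply_cmult by simp
    qed
    obtain n0 where n0: "\<And>n. n \<ge> n0 \<Longrightarrow> cmod (mapply (muhs n) \<Phi> - mapply muh \<Phi>) < e / 2"
      using LIMSEQ_D[OF lim, of "e / 2"] e by auto
    have small: "M * (\<eta> * A) + M' * (\<eta> * A) < e / 2"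
    proof -
      have "(M + M') * (\<eta> * A) < (M + M' + 1) * (\<eta> * A)" using \<eta> A by simp
      also have "\<dots> = e / 2"
      proof -
        have "M + M' + 1 \<noteq> 0" "A \<noteq> 0" using A(2) M(1) M'(1) by linarith+
        moreover have "s * (e / (2 * A * s) * A) = e / 2" if "s \<noteq> 0" "A \<noteq> 0" for s
          using that by simp
        ultimately show ?thesis unfolding \<eta>_def by blast
      qed
      finally show ?thesis by (simp add: algebra_simps)
    qed
    show "\<exists>n0. \<forall>n\<ge>n0. cmod (mapply (muhs n) \<phi> - mapply muh \<phi>) < e"
    proof (intro exI[of _ n0] allI impI)
      fix n assume n: "n \<ge> n0"
      \<comment> \<open>The middle difference is small for large \<open>n\<close>; the two integrals
        of \<open>d\<close> are approximation errors bounded independently of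
        \<open>n\<close>.\<close>
      have "mapply (muhs n) \<phi> - mapply muh \<phi> =
          mapply (muhs n) d + (mapply (muhs n) \<Phi> - mapply muh \<Phi>) - mapply muh d"
        by (simp add: split rad)
      also have "cmod \<dots> \<le> cmod (mapply (muhs n) d + (mapply (muhs n) \<Phi> - mapply muh \<Phi>)) + cmod (mapply muh d)"
        by (rule norm_triangle_ineq4)
      also have "\<dots> \<le> cmod (mapply (muhs n) d) + cmod (mapply (muhs n) \<Phi> - mapply muh \<Phi>) + cmod (mapply muh d)"
        by (intro add_right_mono norm_triangle_ineq)
      also have "\<dots> < e"
        using M(2)[OF d d0 dle, of n] M'(2)[OF d d0 dle] n0[OF n] small by linarith
      finally show "cmod (mapply (muhs n) \<phi> - mapply muh \<phi>) < e" .
    qed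
  qed
qed

end
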